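(* Let $G$ be a finite group, $\mathcal{D}$ a collection of $G$, and $S$ a basic collection of $G$. Then $$|\Omega(G,\mathcal{D})^\times| = 2 \prod_{H \in S \setminus \{G\}} \left|\overline{\Omega(G, \mathrm{S}_{\mathcal{D}}(H))}\right|,$$ where $\overline{\Omega(G, \mathrm{S}_{\mathcal{D}}(H))} := \{x \in \Omega(G, \mathrm{S}_{\mathcal{D}}(H)) \mid x^2 + 2x = 0\}$. Moreover, $$|\Omega(G,\mathcal{D})^\times| = 2 \prod_{H \in S \setminus \{G\}} \left| \left(M^{\mathrm{S}_{\mathcal{D}}(H)}\right)^{-1}\left(\{0,-2\}^{r_H}\right) \cap \mathbb{Z}^{r_H} \right|,$$ where $r_H$ is the number of $G$-conjugacy classes of subgroups in $\mathrm{S}_{\mathcal{D}}(H)$ and $M^{\mathrm{S}_{\mathcal{D}}(H)}$ is the table of marks relative to $\mathrm{S}_{\mathcal{D}}(H)$ of $G$ (an $r_H \times r_H$ matrix). In particular, $$\{-1_{\Omega(G)}\} \cup \bigcup_{H \in S}\ \bigcup_{x \in \overline{\Omega(G, \mathrm{S}_{\mathcal{D}}(H))} \setminus \{0\}} \{1_{\Omega(G)} + x\}$$ is a set of generators of the unit group $\Omega(G,\mathcal{D})^\times$.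
   Context: For a finite group $G$, the Burnside ring $\Omega(G)$ is the Grothendieck ring of the semiring of isomorphism classes of finite left $G$-sets, with addition given by disjoint union and multiplication by Cartesian product. It is a free abelian group with basis the classes $[G/H]$, where $H$ runs over representatives of the conjugacy classes of subgroups of $G$, and $1_{\Omega(G)} = [G/G]$. A family $\mathcal{D}$ of subgroups of $G$ is closed if it is closed under intersection of two members and under $G$-conjugation; a closed family containing $G$ is called a collection of $G$. For a closed family $\mathcal{D}$, $\Omega(G,\mathcal{D})$ denotes the $\mathbb{Z}$-span of $\{[G/H] \mid H \in \mathcal{D}\}$ in $\Omega(G)$ (equal to $\{0\}$ if $\mathcal{D}$ is empty); it is a (possibly non-unital) subring, and it is a unital subring of $\Omega(G)$ if $\mathcal{D}$ is a collection. $R^\times$ denotes the group of units of a ring $R$. A collection $S$ of $G$ is a basic collection if: the trivial subgroup $\langle 1\rangle$ is in $S$; every $H \in S$ is normal in $G$; and $HK \in S$ whenever $H, K \in S$. For a collection $\mathcal{D}$, a basic collection $S$ and $H \in S$, put $$\mathrm{S}_{\mathcal{D}}(H) := \{F \in \mathcal{D} \mid H \leq F,\ \text{and if } H' \in S \text{ and } H \leq H' \leq F, \text{ then } H = H'\}.$$ This is a (possibly empty) closed family of subgroups of $G$. For a closed family $\mathcal{E}$, the table of marks relative to $\mathcal{E}$ of $G$ is the square matrix $M^{\mathcal{E}} = (\#\{x \in G/H \mid kx = x \text{ for all } k \in K\})_{K,H}$, with rows $K$ and columns $H$ indexed by representatives of the $G$-conjugacy classes of subgroups in $\mathcal{E}$;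 it is invertible over $\mathbb{Q}$. When $\mathcal{E}$ is empty, the corresponding factor in the second product is $1$. *)

theory Defs
  imports
    "HOL-Algebra.Group_Action"
    "HOL-Algebra.Generated_Groups"
    "HOL-Algebra.Left_Coset"
    "Jordan_Normal_Form.Gauss_Jordan_Elimination"
begin

section \<open>Grothendieck ring of a commutative semiring\<close>

text \<open>
  The pair \<open>(a, b)\<close> stands for the formal difference \<open>a - b\<close>. The summand \<open>e\<close> is what makes the
  relation transitive when addition is not cancellative.
\<close>

definition groth_rel :: "('a, 'm) ring_scheme \<Rightarrow> (('a \<times> 'a) \<times> ('a \<times> 'a)) set" where
  "groth_rel R = {((a, b), (c, d)).
     a \<in> carrier R \<and> b \<in> carrier R \<and> c \<in> carrier R \<and> d \<in> carrier R \<and>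
     (\<exists>e \<in> carrier R. (a \<oplus>\<^bsub>R\<^esub> d) \<oplus>\<^bsub>R\<^esub> e = (c \<oplus>\<^bsub>R\<^esub> b) \<oplus>\<^bsub>R\<^esub> e)}"

definition groth_ring :: "('a, 'm) ring_scheme \<Rightarrow> ('a \<times> 'a) set ring" where
  "groth_ring R =
     \<lparr> carrier = (carrier R \<times> carrier R) // groth_rel R,
       monoid.mult = (\<lambda>P Q. \<Union>(a, b) \<in> P. \<Union>(c, d) \<in> Q.
          groth_rel R `` {((a \<otimes>\<^bsub>R\<^esub> c) \<oplus>\<^bsub>R\<^esub> (b \<otimes>\<^bsub>R\<^esub> d), (a \<otimes>\<^bsub>R\<^esub> d) \<oplus>\<^bsub>R\<^esub> (b \<otimes>\<^bsub>R\<^esub> c))}),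
       monoid.one = groth_rel R `` {(\<one>\<^bsub>R\<^esub>, \<zero>\<^bsub>R\<^esub>)},
       ring.zero = groth_rel R `` {(\<zero>\<^bsub>R\<^esub>, \<zero>\<^bsub>R\<^esub>)},
       ring.add = (\<lambda>P Q. \<Union>(a, b) \<in> P. \<Union>(c, d) \<in> Q.
          groth_rel R `` {(a \<oplus>\<^bsub>R\<^esub> c, b \<oplus>\<^bsub>R\<^esub> d)}) \<rparr>"

definition groth_of :: "('a, 'm) ring_scheme \<Rightarrow> 'a \<Rightarrow> ('a \<times> 'a) set" where
  "groth_of R a = groth_rel R `` {(a, \<zero>\<^bsub>R\<^esub>)}"


section \<open>The semiring of isomorphism classes of finite left \<open>G\<close>-sets\<close>

text \<open>
  A left \<open>G\<close>-set is a set \<open>X\<close> with an action \<open>\<phi>\<close> satisfying \<^locale>\<open>group_action\<close>. Isomorphism classes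
  are formed inside the \<open>G\<close>-sets whose underlying set is a finite set of natural numbers; every
  finite \<open>G\<close>-set, over any type, is isomorphic to one of these.
\<close>

definition gset_iso ::
  "('g, 'm) monoid_scheme \<Rightarrow> 'x set \<Rightarrow> ('g \<Rightarrow> 'x \<Rightarrow> 'x) \<Rightarrow> 'y set \<Rightarrow> ('g \<Rightarrow> 'y \<Rightarrow> 'y) \<Rightarrow> bool" where
  "gset_iso G X \<phi> Y \<psi> \<longleftrightarrow>
     (\<exists>f. bij_betw f X Y \<and> (\<forall>g \<in> carrier G. \<forall>x \<in> X. f (\<phi> g x) = \<psi> g (f x)))"

type_synonym 'g gset_cls = "(nat set \<times> ('g \<Rightarrow> nat \<Rightarrow> nat)) set"

definition gset_class ::
  "('g, 'm) monoid_scheme \<Rightarrow> 'x set \<Rightarrow> ('g \<Rightarrow> 'x \<Rightarrow> 'x) \<Rightarrow> 'g gset_cls" where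
  "gset_class G X \<phi> = {(Y, \<psi>). finite Y \<and> group_action G Y \<psi> \<and> gset_iso G X \<phi> Y \<psi>}"

definition sum_action ::
  "'x set \<Rightarrow> ('g \<Rightarrow> 'x \<Rightarrow> 'x) \<Rightarrow> 'y set \<Rightarrow> ('g \<Rightarrow> 'y \<Rightarrow> 'y) \<Rightarrow> 'g \<Rightarrow> 'x + 'y \<Rightarrow> 'x + 'y" where
  "sum_action X \<phi> Y \<psi> = (\<lambda>g. \<lambda>z \<in> X <+> Y. map_sum (\<phi> g) (\<psi> g) z)"

definition prod_action ::
  "'x set \<Rightarrow> ('g \<Rightarrow> 'x \<Rightarrow> 'x) \<Rightarrow> 'y set \<Rightarrow> ('g \<Rightarrow> 'y \<Rightarrow> 'y) \<Rightarrow> 'g \<Rightarrow> 'x \<times> 'y \<Rightarrow> 'x \<times> 'y" where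
  "prod_action X \<phi> Y \<psi> = (\<lambda>g. \<lambda>z \<in> X \<times> Y. map_prod (\<phi> g) (\<psi> g) z)"

definition gset_semiring :: "('g, 'm) monoid_scheme \<Rightarrow> 'g gset_cls ring" where
  "gset_semiring G =
     \<lparr> carrier = {gset_class G X \<phi> | (X :: nat set) \<phi>. finite X \<and> group_action G X \<phi>},
       monoid.mult = (\<lambda>A B. \<Union>(X, \<phi>) \<in> A. \<Union>(Y, \<psi>) \<in> B. gset_class G (X \<times> Y) (prod_action X \<phi> Y \<psi>)),
       monoid.one = gset_class G {0 :: nat} (\<lambda>g. \<lambda>x \<in> {0}. x),
       ring.zero = gset_class G ({} :: nat set) (\<lambda>g. \<lambda>x \<in> {}. x),
       ring.add = (\<lambda>A B. \<Union>(X, \<phi>) \<in> A. \<Union>(Y, \<psi>) \<in> B. gset_class G (X <+> Y) (sum_action X \<phi> Y \<psi>)) \<rparr>"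


section \<open>The Burnside ring\<close>

type_synonym 'g burnside_elt = "('g gset_cls \<times> 'g gset_cls) set"

definition burnside_ring :: "('g, 'm) monoid_scheme \<Rightarrow> 'g burnside_elt ring" where
  "burnside_ring G = groth_ring (gset_semiring G)"

definition coset_action ::
  "('g, 'm) monoid_scheme \<Rightarrow> 'g set \<Rightarrow> 'g \<Rightarrow> 'g set \<Rightarrow> 'g set" where
  "coset_action G H = (\<lambda>g. \<lambda>C \<in> lcosets\<^bsub>G\<^esub> H. g <#\<^bsub>G\<^esub> C)"

definition burnside_basis :: "('g, 'm) monoid_scheme \<Rightarrow> 'g set \<Rightarrow> 'g burnside_elt" where
  "burnside_basis G H =
     groth_of (gset_semiring G) (gset_class G (lcosets\<^bsub>G\<^esub> H) (coset_action G H))"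

text \<open>
  The \<open>\<int>\<close>-span \<open>\<Omega>(G, \<E>)\<close>, as the additive subgroup generated by the classes \<open>[G/H]\<close>; it is \<open>{0}\<close>
  for empty \<open>\<E>\<close>.
\<close>

definition burnside_span :: "('g, 'm) monoid_scheme \<Rightarrow> 'g set set \<Rightarrow> 'g burnside_elt set" where
  "burnside_span G \<E> = generate (add_monoid (burnside_ring G)) (burnside_basis G ` \<E>)"

text \<open>The subring \<open>\<Omega>(G, \<D>)\<close> with the unit of \<open>\<Omega>(G)\<close>; meant for collections \<open>\<D>\<close>.\<close>

definition burnside_subring :: "('g, 'm) monoid_scheme \<Rightarrow> 'g set set \<Rightarrow> 'g burnside_elt ring" where
  "burnside_subring G \<D> = (burnside_ring G)\<lparr>carrier := burnside_span G \<D>\<rparr>"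

definition burnside_bar :: "('g, 'm) monoid_scheme \<Rightarrow> 'g set set \<Rightarrow> 'g burnside_elt set" where
  "burnside_bar G \<E> = {x \<in> burnside_span G \<E>.
     x [^]\<^bsub>burnside_ring G\<^esub> (2::nat) \<oplus>\<^bsub>burnside_ring G\<^esub> add_pow (burnside_ring G) (2::nat) x
       = \<zero>\<^bsub>burnside_ring G\<^esub>}"


section \<open>Closed families, collections and basic collections\<close>

definition conj_subgroup :: "('g, 'm) monoid_scheme \<Rightarrow> 'g \<Rightarrow> 'g set \<Rightarrow> 'g set" where
  "conj_subgroup G g H = (g <#\<^bsub>G\<^esub> H) #>\<^bsub>G\<^esub> (inv\<^bsub>G\<^esub> g)"

definition closed_family :: "('g, 'm) monoid_scheme \<Rightarrow> 'g set set \<Rightarrow> bool" where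
  "closed_family G \<D> \<longleftrightarrow>
     (\<forall>H \<in> \<D>. subgroup H G) \<and>
     (\<forall>H \<in> \<D>. \<forall>K \<in> \<D>. H \<inter> K \<in> \<D>) \<and>
     (\<forall>H \<in> \<D>. \<forall>g \<in> carrier G. conj_subgroup G g H \<in> \<D>)"

definition collection :: "('g, 'm) monoid_scheme \<Rightarrow> 'g set set \<Rightarrow> bool" where
  "collection G \<D> \<longleftrightarrow> closed_family G \<D> \<and> carrier G \<in> \<D>"

definition basic_collection :: "('g, 'm) monoid_scheme \<Rightarrow> 'g set set \<Rightarrow> bool" where
  "basic_collection G S \<longleftrightarrow>
     collection G S \<and>
     {\<one>\<^bsub>G\<^esub>} \<in> S \<and>
     (\<forall>H \<in> S. H \<lhd> G) \<and>
     (\<forall>H \<in> S. \<forall>K \<in> S. H <#>\<^bsub>G\<^esub> K \<in> S)"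

definition S_family :: "'g set set \<Rightarrow> 'g set set \<Rightarrow> 'g set \<Rightarrow> 'g set set" where
  "S_family \<D> S H = {F \<in> \<D>. H \<subseteq> F \<and> (\<forall>H' \<in> S. H \<subseteq> H' \<and> H' \<subseteq> F \<longrightarrow> H = H')}"


section \<open>Tables of marks\<close>

definition conj_rel :: "('g, 'm) monoid_scheme \<Rightarrow> 'g set set \<Rightarrow> ('g set \<times> 'g set) set" where
  "conj_rel G \<E> = {(H, K). H \<in> \<E> \<and> K \<in> \<E> \<and> (\<exists>g \<in> carrier G. K = conj_subgroup G g H)}"

definition num_conj_classes :: "('g, 'm) monoid_scheme \<Rightarrow> 'g set set \<Rightarrow> nat" where
  "num_conj_classes G \<E> = card (\<E> // conj_rel G \<E>)"

text \<open>An enumeration, in some order, of representatives of the conjugacy classes in \<open>\<E>\<close>.\<close>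

definition conj_reps :: "('g, 'm) monoid_scheme \<Rightarrow> 'g set set \<Rightarrow> 'g set list \<Rightarrow> bool" where
  "conj_reps G \<E> Hs \<longleftrightarrow>
     distinct Hs \<and> set Hs \<subseteq> \<E> \<and> (\<forall>C \<in> \<E> // conj_rel G \<E>. \<exists>!H. H \<in> set Hs \<and> H \<in> C)"

definition table_of_marks :: "('g, 'm) monoid_scheme \<Rightarrow> 'g set list \<Rightarrow> rat mat" where
  "table_of_marks G Hs = mat (length Hs) (length Hs)
     (\<lambda>(i, j). of_nat (card {x \<in> lcosets\<^bsub>G\<^esub> (Hs ! j). \<forall>k \<in> Hs ! i. coset_action G (Hs ! j) k x = x}))"

text \<open>
  The set \<open>M\<^sup>-\<^sup>1({0,-2}\<^sup>r) \<inter> \<int>\<^sup>r\<close>, for \<open>M\<close> an \<open>r \<times> r\<close> matrix invertible over the rationals. For \<open>r = 0\<close> it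
  consists of the empty vector, so an empty family contributes a factor 1.
\<close>

definition integral_preimages :: "nat \<Rightarrow> rat mat \<Rightarrow> rat vec set" where
  "integral_preimages r M =
     (\<lambda>w. the (mat_inverse M) *\<^sub>v w) ` {w \<in> carrier_vec r. \<forall>i < r. w $ i \<in> {0, -2}}
     \<inter> {v \<in> carrier_vec r. \<forall>i < r. v $ i \<in> \<int>}"

end

theory Submission
  imports Defs "HOL-Library.Function_Algebras" "Jordan_Normal_Form.Determinant"
begin

text \<open>
  \<^bold>\<open>Marks.\<close> The mark of a finite \<open>G\<close>-set \<open>X\<close> at \<open>K\<close> is the number of points of \<open>X\<close> fixed by \<open>K\<close>. Marks
  turn disjoint unions into sums and products into products, and Burnside's theorem
  (\<open>gset_iso_if_mark_eq\<close>) says that they determine \<open>X\<close> up to isomorphism. Hence the Burnside ring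
  is a ring of integer-valued functions on subsets of \<open>G\<close> under pointwise operations, \<open>\<Omega>(G, \<E>)\<close>
  is the set \<open>mark_span G \<E>\<close> of integral combinations of the marks of \<open>G/F\<close>, \<open>F \<in> \<E>\<close>, a unit is a
  function with values in \<open>{1, -1}\<close>, that is, of square 1, and \<open>x\<^sup>2 + 2x = 0\<close> says that
  \<open>1 + x\<close> has square 1. A ring of functions makes all ring axioms free, so the argument below
  takes place there and is carried over to the Burnside ring at the end.

  \<^bold>\<open>The grading.\<close> Every \<open>F \<in> \<D>\<close> contains a largest member of \<open>S\<close>, as \<open>S\<close> contains 1 and is
  closed under products. Sorting \<open>\<D>\<close> by this core splits it into the families \<open>S\<^sub>\<D>(H)\<close>, and
  \<open>\<Omega>(G, \<D>)\<close> into pieces indexed by \<open>S\<close>. For \<open>H \<in> S\<close>, which is normal, sending \<open>X\<close> to its subset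
  \<open>X\<^sup>H\<close> of \<open>H\<close>-fixed points is a ring endomorphism \<open>p\<^sub>H\<close>; on marks it is the substitution
  \<open>f \<mapsto> (K \<mapsto> f (K \<union> H))\<close>, and it keeps the pieces with index above \<open>H\<close> and kills all others
  (\<open>fixed_part_fam\<close>).

  \<^bold>\<open>Factoring units.\<close> Each \<open>1 + x\<close> with \<open>x\<close> in a set \<open>bar(H)\<close> of solutions of \<open>x\<^sup>2 + 2x = 0\<close> in
  the piece of index \<open>H\<close> is a unit, and every unit is uniquely a product of such factors, one for each
  \<open>H \<in> S\<close> (\<open>bij_prod_one_plus\<close>). Indeed, \<open>p\<^sub>L\<close> maps \<open>\<Prod>\<^sub>H (1 + x\<^sub>H)\<close> to the partial product over
  \<open>H \<ge> L\<close>, so the factors can be recovered one at a time, going down in \<open>S\<close>. For a given unit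
  \<open>u\<close> the factor at \<open>H\<close> has to be \<open>v = p\<^sub>H(u) \<cdot> \<Prod>\<^bsub>K > H\<^esub> (1 + x\<^sub>K)\<close>, since the product is its own
  inverse. All \<open>p\<^sub>L\<close> with \<open>L > H\<close> send \<open>v\<close> to 1, and this forces \<open>v - 1\<close> into the piece of index \<open>H\<close>
  (\<open>mark_span_fam_if_fixed_part\<close>). Counting the factors gives the first formula, in which the factor
  at \<open>H = G\<close> is \<open>{1, -1}\<close>, and the factorisation itself gives the generators.

  \<^bold>\<open>Tables of marks.\<close> A function in \<open>\<Omega>(G, \<E>)\<close>, \<open>\<E>\<close> closed, is determined by its values on \<open>\<E>\<close>:
  \<open>K\<close> may be replaced by the smallest member of \<open>\<E>\<close> that contains it (\<open>mark_span_closure\<close>). So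
  \<open>bar(H)\<close> consists of the integral combinations whose values at representatives of the
  conjugacy classes lie in \<open>{0, -2}\<close>, and the coordinates of these combinations form
  \<open>M\<^sup>-\<^sup>1({0,-2}\<^sup>r) \<inter> \<int>\<^sup>r\<close>. The table \<open>M\<close> is invertible as it is triangular when the representatives
  are ordered by size (\<open>M_kernel\<close>).
\<close>

section \<open>Fixed points, orbits and marks of actions\<close>

definition action_stable :: "('g, 'm) monoid_scheme \<Rightarrow> ('g \<Rightarrow> 'x \<Rightarrow> 'x) \<Rightarrow> 'x set \<Rightarrow> bool" where
  "action_stable G \<phi> U \<longleftrightarrow> (\<forall>g \<in> carrier G. \<forall>x \<in> U. \<phi> g x \<in> U)"

text \<open>
  Intersecting with the carrier gives fixed points, and so marks, a meaning for every set \<open>K\<close>; the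
  mark of the one-point \<open>G\<close>-set is then the constant function 1, the unit of the function ring.
\<close>

definition fixed_points ::
  "('g, 'm) monoid_scheme \<Rightarrow> 'x set \<Rightarrow> ('g \<Rightarrow> 'x \<Rightarrow> 'x) \<Rightarrow> 'g set \<Rightarrow> 'x set" where
  "fixed_points G X \<phi> K = {x \<in> X. \<forall>k \<in> K \<inter> carrier G. \<phi> k x = x}"

definition mark ::
  "('g, 'm) monoid_scheme \<Rightarrow> 'x set \<Rightarrow> ('g \<Rightarrow> 'x \<Rightarrow> 'x) \<Rightarrow> 'g set \<Rightarrow> int" where
  "mark G X \<phi> K = int (card (fixed_points G X \<phi> K))"

definition basis_mark :: "('g, 'm) monoid_scheme \<Rightarrow> 'g set \<Rightarrow> 'g set \<Rightarrow> int" where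
  "basis_mark G H = mark G (lcosets\<^bsub>G\<^esub> H) (coset_action G H)"

lemma mark_disjoint_Un:
  assumes "finite U" "finite V" "U \<inter> V = {}"
  shows "mark G (U \<union> V) \<phi> = mark G U \<phi> + mark G V \<phi>"
proof
  fix K
  have "fixed_points G (U \<union> V) \<phi> K = fixed_points G U \<phi> K \<union> fixed_points G V \<phi> K"
    by (auto simp: fixed_points_def)
  moreover have "card (fixed_points G U \<phi> K \<union> fixed_points G V \<phi> K)
      = card (fixed_points G U \<phi> K) + card (fixed_points G V \<phi> K)"
    by (rule card_Un_disjoint) (use assms in \<open>auto simp: fixed_points_def\<close>)
  ultimately show "mark G (U \<union> V) \<phi> K = (mark G U \<phi> + mark G V \<phi>) K"
    by (simp add: mark_def)
qed

lemma mark_gset_iso: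
  assumes "action_stable G \<phi> U" "gset_iso G U \<phi> V \<psi>"
  shows "mark G U \<phi> = mark G V \<psi>"
proof
  fix K
  obtain f where f: "bij_betw f U V" "\<And>g x. g \<in> carrier G \<Longrightarrow> x \<in> U \<Longrightarrow> f (\<phi> g x) = \<psi> g (f x)"
    using assms(2) by (auto simp: gset_iso_def)
  have inj: "inj_on f U" and im: "f ` U = V" using f(1) by (auto simp: bij_betw_def)
  have "\<phi> g x = x \<longleftrightarrow> \<psi> g (f x) = f x" if "g \<in> carrier G" "x \<in> U" for g x
    using f(2)[OF that] inj that assms(1) by (metis inj_onD action_stable_def)
  hence "f ` fixed_points G U \<phi> K = fixed_points G V \<psi> K"
    unfolding fixed_points_def im[symmetric] by auto
  moreover have "inj_on f (fixed_points G U \<phi> K)"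
    using inj by (rule inj_on_subset) (auto simp: fixed_points_def)
  ultimately show "mark G U \<phi> K = mark G V \<psi> K"
    unfolding mark_def by (metis card_image)
qed

lemma gset_iso_disjoint_Un:
  assumes "gset_iso G U \<phi> V \<psi>" "gset_iso G U' \<phi> V' \<psi>"
    and "action_stable G \<phi> U" "action_stable G \<phi> U'" "U \<inter> U' = {}" "V \<inter> V' = {}"
  shows "gset_iso G (U \<union> U') \<phi> (V \<union> V') \<psi>"
proof -
  obtain f where f: "bij_betw f U V" "\<And>g x. g \<in> carrier G \<Longrightarrow> x \<in> U \<Longrightarrow> f (\<phi> g x) = \<psi> g (f x)"
    using assms(1) by (auto simp: gset_iso_def)
  obtain f' where f': "bij_betw f' U' V'"
    "\<And>g x. g \<in> carrier G \<Longrightarrow> x \<in> U' \<Longrightarrow> f' (\<phi> g x) = \<psi> g (f' x)"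
    using assms(2) by (auto simp: gset_iso_def)
  let ?h = "\<lambda>x. if x \<in> U then f x else f' x"
  have "bij_betw ?h (U \<union> U') (V \<union> V')"
  proof (rule bij_betw_combine[OF _ _ assms(6)])
    show "bij_betw ?h U V" using f(1) by (simp cong: bij_betw_cong)
    show "bij_betw ?h U' V'"
      using f'(1) assms(5) by (subst bij_betw_cong[where g = f']) auto
  qed
  moreover have "?h (\<phi> g x) = \<psi> g (?h x)" if "g \<in> carrier G" "x \<in> U \<union> U'" for g x
    using that f(2) f'(2) assms(3-5) unfolding action_stable_def by (cases "x \<in> U") auto
  ultimately show ?thesis unfolding gset_iso_def by blast
qed

lemma group_actionI:
  fixes G (structure)
  assumes "group G"
    and ext: "\<And>g. g \<in> carrier G \<Longrightarrow> \<phi> g \<in> extensional X"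
    and closed: "\<And>g x. g \<in> carrier G \<Longrightarrow> x \<in> X \<Longrightarrow> \<phi> g x \<in> X"
    and mult: "\<And>g h x. g \<in> carrier G \<Longrightarrow> h \<in> carrier G \<Longrightarrow> x \<in> X \<Longrightarrow>
      \<phi> (g \<otimes>\<^bsub>G\<^esub> h) x = \<phi> g (\<phi> h x)"
    and one: "\<And>x. x \<in> X \<Longrightarrow> \<phi> \<one>\<^bsub>G\<^esub> x = x"
  shows "group_action G X \<phi>"
proof -
  interpret group G by fact
  have bij: "\<phi> g \<in> Bij X" if g: "g \<in> carrier G" for g
  proof -
    have "bij_betw (\<phi> g) X X"
      by (rule bij_betw_byWitness[where f' = "\<phi> (inv g)"])
        (use g closed one mult[of g "inv g"] mult[of "inv g" g] in auto)
    thus ?thesis using ext[OF g] by (simp add: Bij_def)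
  qed
  have "\<phi> (g \<otimes> h) = compose X (\<phi> g) (\<phi> h)" if "g \<in> carrier G" "h \<in> carrier G" for g h
    by (rule extensionalityI[of _ X]) (use that ext mult in \<open>auto simp: compose_def\<close>)
  hence "\<phi> \<in> hom G (BijGroup X)"
    using bij by (auto simp: hom_def BijGroup_def)
  thus ?thesis
    by (simp add: group_action_def group_hom_def group_hom_axioms_def group_BijGroup assms(1))
qed

lemma stable_action: "group_action G X \<phi> \<Longrightarrow> action_stable G \<phi> X"
  by (auto simp: action_stable_def dest: group_action.element_image)

lemma group_action_closed:
  "group_action G X \<phi> \<Longrightarrow> g \<in> carrier G \<Longrightarrow> x \<in> X \<Longrightarrow> \<phi> g x \<in> X"
  by (auto dest: group_action.element_image)

lemma action_group: "group_action G X \<phi> \<Longrightarrow> group G"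
  by (simp add: group_action_def group_hom_def)

lemma group_action_one:
  assumes "group_action G X \<phi>" "x \<in> X" shows "\<phi> \<one>\<^bsub>G\<^esub> x = x"
  using group_action.id_eq_one[OF assms(1)] assms(2) by (metis restrict_apply')

lemma group_action_inv_apply:
  fixes G (structure)
  assumes "group_action G X \<phi>" "g \<in> carrier G" "x \<in> X"
  shows "\<phi> (inv\<^bsub>G\<^esub> g) (\<phi> g x) = x"
proof -
  interpret group G using action_group[OF assms(1)] .
  have "\<phi> (inv g) (\<phi> g x) = \<phi> (inv g \<otimes> g) x"
    by (rule group_action.composition_rule[OF assms(1,3) inv_closed[OF assms(2)] assms(2), symmetric])
  thus ?thesis using assms group_action_one by simp
qed

lemma orbit_subset: "group_action G X \<phi> \<Longrightarrow> x \<in> X \<Longrightarrow> orbit G \<phi> x \<subseteq> X"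
  by (auto simp: orbit_def dest: group_action.element_image)

lemma orbit_self: "group_action G X \<phi> \<Longrightarrow> x \<in> X \<Longrightarrow> x \<in> orbit G \<phi> x"
  by (rule group_action.orbit_refl)

lemma stable_orbit:
  fixes G (structure)
  assumes "group_action G X \<phi>" "x \<in> X"
  shows "action_stable G \<phi> (orbit G \<phi> x)"
proof -
  interpret group G using action_group[OF assms(1)] .
  have "\<phi> g (\<phi> h x) \<in> orbit G \<phi> x" if "g \<in> carrier G" "h \<in> carrier G" for g h
    using group_action.composition_rule[OF assms(1) assms(2) that] that
    unfolding orbit_def by (auto intro!: exI[of _ "g \<otimes> h"])
  thus ?thesis by (auto simp: action_stable_def orbit_def)
qed

lemma orbit_subset_stable: "action_stable G \<phi> U \<Longrightarrow> x \<in> U \<Longrightarrow> orbit G \<phi> x \<subseteq> U"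
  by (auto simp: orbit_def action_stable_def)

lemma stable_Diff_orbit:
  fixes G (structure)
  assumes "group_action G X \<phi>" "U \<subseteq> X" "action_stable G \<phi> U" "x \<in> U"
  shows "action_stable G \<phi> (U - orbit G \<phi> x)"
proof -
  interpret group G using action_group[OF assms(1)] .
  have "y \<in> orbit G \<phi> x" if "g \<in> carrier G" "y \<in> U" "\<phi> g y \<in> orbit G \<phi> x" for g y
  proof -
    have "\<phi> (inv g) (\<phi> g y) \<in> orbit G \<phi> x"
      using stable_orbit[OF assms(1), of x] that assms unfolding action_stable_def by blast
    thus ?thesis using group_action_inv_apply[OF assms(1) that(1)] that assms by auto
  qed
  thus ?thesis using assms(3) unfolding action_stable_def by blast
qed

lemma act_eq_iff_stabilizer:
  fixes G (structure)
  assumes "group_action G X \<phi>" "x \<in> X" "g \<in> carrier G" "h \<in> carrier G"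
  shows "\<phi> g x = \<phi> h x \<longleftrightarrow> inv h \<otimes> g \<in> stabilizer G \<phi> x"
proof -
  interpret group G using action_group[OF assms(1)] .
  interpret A: group_action G X \<phi> by fact
  have "\<phi> (inv h \<otimes> g) x = \<phi> (inv h) (\<phi> g x)" using A.composition_rule assms by simp
  moreover have "\<phi> h (\<phi> (inv h) (\<phi> g x)) = \<phi> g x"
    using group_action_inv_apply[OF assms(1) inv_closed[OF assms(4)]
        group_action_closed[OF assms(1,3,2)]] assms by simp
  moreover have "\<phi> (inv h) (\<phi> h x) = x"
    using group_action_inv_apply[OF assms(1)] assms by simp
  ultimately show ?thesis using assms by (auto simp: stabilizer_def)
qed

text \<open>
  An orbit is determined by a stabilizer: \<open>\<phi> g x \<mapsto> \<psi> g y\<close> is well defined and injective because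
  \<open>\<phi> g x = \<phi> h x\<close> and \<open>\<psi> g y = \<psi> h y\<close> both express that \<open>h\<^sup>-\<^sup>1g\<close> lies in the common stabilizer.
\<close>

lemma gset_iso_orbit:
  fixes G (structure)
  assumes X: "group_action G X \<phi>" and Y: "group_action G Y \<psi>"
    and x: "x \<in> X" and y: "y \<in> Y"
    and st: "stabilizer G \<phi> x = stabilizer G \<psi> y"
  shows "gset_iso G (orbit G \<phi> x) \<phi> (orbit G \<psi> y) \<psi>"
proof -
  interpret group G using action_group[OF X] .
  have eq: "\<phi> g x = \<phi> h x \<longleftrightarrow> \<psi> g y = \<psi> h y" if "g \<in> carrier G" "h \<in> carrier G" for g h
    using act_eq_iff_stabilizer[OF X x that] act_eq_iff_stabilizer[OF Y y that] st by simp
  define f where "f z = \<psi> (SOME g. g \<in> carrier G \<and> \<phi> g x = z) y" for z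
  have f: "f (\<phi> g x) = \<psi> g y" if "g \<in> carrier G" for g
  proof -
    let ?h = "SOME h. h \<in> carrier G \<and> \<phi> h x = \<phi> g x"
    have "?h \<in> carrier G \<and> \<phi> ?h x = \<phi> g x" by (rule someI[of _ g]) (use that in simp)
    thus ?thesis using eq that unfolding f_def by blast
  qed
  have "bij_betw f (orbit G \<phi> x) (orbit G \<psi> y)"
    unfolding bij_betw_def inj_on_def
    by (auto simp: orbit_def f eq image_iff) (metis f)
  moreover have "f (\<phi> g z) = \<psi> g (f z)" if g: "g \<in> carrier G" and z: "z \<in> orbit G \<phi> x" for g z
  proof -
    obtain h where h: "h \<in> carrier G" "z = \<phi> h x" using z by (auto simp: orbit_def)
    have "f (\<phi> g z) = f (\<phi> (g \<otimes> h) x)"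
      using h group_action.composition_rule[OF X x g h(1)] by simp
    also have "\<dots> = \<psi> g (f z)"
      using f h g group_action.composition_rule[OF Y y g h(1)] by simp
    finally show ?thesis .
  qed
  ultimately show ?thesis unfolding gset_iso_def by blast
qed

lemma fixed_points_iff_stabilizer:
  "x \<in> fixed_points G X \<phi> K \<longleftrightarrow> x \<in> X \<and> K \<inter> carrier G \<subseteq> stabilizer G \<phi> x"
  by (auto simp: fixed_points_def stabilizer_def)

locale finite_group = group +
  assumes finite_carrier: "finite (carrier G)"

lemma mark_nonzero_iff:
  "finite U \<Longrightarrow> mark G U \<phi> K \<noteq> 0 \<longleftrightarrow> (\<exists>x \<in> U. K \<inter> carrier G \<subseteq> stabilizer G \<phi> x)"
  unfolding mark_def using fixed_points_iff_stabilizer[of _ G U \<phi> K]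
  by (auto simp: card_eq_0_iff fixed_points_def stabilizer_def)

context finite_group
begin

text \<open>
  Burnside's theorem, for stable subsets of two actions so that orbits can be removed without
  changing the actions. Let \<open>x \<in> U\<close> have a stabilizer of maximal order. Equal marks give \<open>y \<in> V\<close> fixed
  by this stabilizer, and then \<open>z \<in> U\<close> fixed by the stabilizer of \<open>y\<close>; by maximality the three
  stabilizers coincide. So the orbits of \<open>x\<close> and \<open>y\<close> are isomorphic, and removing them lowers
  both marks by the same function.
\<close>

theorem gset_iso_if_mark_eq:
  assumes X: "group_action G X \<phi>" and Y: "group_action G Y \<psi>"
  assumes "U \<subseteq> X" "action_stable G \<phi> U" "finite U" "V \<subseteq> Y" "action_stable G \<psi> V" "finite V"
    and "mark G U \<phi> = mark G V \<psi>"
  shows "gset_iso G U \<phi> V \<psi>"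
  using assms(3-)
proof (induction "card U" arbitrary: U V rule: less_induct)
  case less
  show ?case
  proof (cases "U = {}")
    case True
    have "mark G V \<psi> {} = 0"
      using less.prems(7) True by (metis fixed_points_def mark_nonzero_iff equals0D finite.emptyI)
    hence "V = {}"
      using mark_nonzero_iff[OF less.prems(6), of G \<psi> "{}"] by auto
    thus ?thesis using True by (auto simp: gset_iso_def bij_betw_def)
  next
    case False
    let ?s = "\<lambda>x. card (stabilizer G \<phi> x)"
    have "Max (?s ` U) \<in> ?s ` U" using False less.prems(3) by simp
    then obtain x where x: "x \<in> U" and "?s x = Max (?s ` U)" by auto
    hence max: "?s z \<le> ?s x" if "z \<in> U" for z using that less.prems(3) by simp
    have xX: "x \<in> X" using x less.prems by auto
    have sub: "stabilizer G \<phi> z \<subseteq> carrier G" "stabilizer G \<psi> w \<subseteq> carrier G" for z w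
      by (auto simp: stabilizer_def)
    have "mark G V \<psi> (stabilizer G \<phi> x) \<noteq> 0"
      using less.prems(3,7) x by (metis Int_lower1 mark_nonzero_iff)
    then obtain y where y: "y \<in> V" "stabilizer G \<phi> x \<subseteq> stabilizer G \<psi> y"
      using less.prems(6) sub by (metis inf.orderE mark_nonzero_iff)
    have "mark G U \<phi> (stabilizer G \<psi> y) \<noteq> 0"
      using less.prems(6,7) y by (metis Int_lower1 mark_nonzero_iff)
    then obtain z where z: "z \<in> U" "stabilizer G \<psi> y \<subseteq> stabilizer G \<phi> z"
      using less.prems(3) sub by (metis inf.orderE mark_nonzero_iff)
    have "finite (stabilizer G \<phi> z)" using sub finite_carrier finite_subset by blast
    hence "stabilizer G \<phi> x = stabilizer G \<phi> z"
      using max[OF z(1)] y z by (metis card_seteq subset_trans)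
    hence st: "stabilizer G \<phi> x = stabilizer G \<psi> y" using y z by auto
    have yY: "y \<in> Y" using y less.prems by auto
    let ?O = "orbit G \<phi> x" and ?P = "orbit G \<psi> y"
    have O: "?O \<subseteq> U" "?P \<subseteq> V" using orbit_subset_stable x y less.prems by metis+
    have fin: "finite ?O" "finite ?P" "finite (U - ?O)" "finite (V - ?P)"
      using O less.prems finite_subset by blast+
    have iso: "gset_iso G ?O \<phi> ?P \<psi>" by (rule gset_iso_orbit[OF X Y xX yY st])
    have m: "mark G ?O \<phi> = mark G ?P \<psi>" by (rule mark_gset_iso[OF stable_orbit[OF X xX] iso])
    have "mark G U \<phi> = mark G ?O \<phi> + mark G (U - ?O) \<phi>"
      using mark_disjoint_Un[OF fin(1,3)] O by (metis Diff_disjoint Un_Diff_cancel Un_absorb1)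
    moreover have "mark G V \<psi> = mark G ?P \<psi> + mark G (V - ?P) \<psi>"
      using mark_disjoint_Un[OF fin(2,4)] O by (metis Diff_disjoint Un_Diff_cancel Un_absorb1)
    ultimately have m': "mark G (U - ?O) \<phi> = mark G (V - ?P) \<psi>"
      using m less.prems(7) by (metis add_left_cancel)
    have "x \<in> ?O" by (rule orbit_self[OF X xX])
    hence "card (U - ?O) < card U" using x less.prems(3) by (intro psubset_card_mono) auto
    hence "gset_iso G (U - ?O) \<phi> (V - ?P) \<psi>"
      using less.prems O fin m' x y
      by (intro less.hyps stable_Diff_orbit[OF X] stable_Diff_orbit[OF Y]) auto
    from gset_iso_disjoint_Un[OF iso this stable_orbit[OF X xX]
        stable_Diff_orbit[OF X less.prems(1,2) x]]
    have "gset_iso G (?O \<union> (U - ?O)) \<phi> (?P \<union> (V - ?P)) \<psi>" by blast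
    moreover have "?O \<union> (U - ?O) = U" "?P \<union> (V - ?P) = V" using O by auto
    ultimately show ?thesis by simp
  qed
qed

end

section \<open>Coset actions\<close>

lemma lcosets_eq_image: "lcosets\<^bsub>G\<^esub> H = (\<lambda>g. g <#\<^bsub>G\<^esub> H) ` carrier G"
  by (auto simp: LCOSETS_def)

context finite_group
begin

lemma mem_conj_subgroup_iff:
  assumes "subgroup H G" "g \<in> carrier G" "x \<in> carrier G"
  shows "x \<in> conj_subgroup G g H \<longleftrightarrow> inv g \<otimes> x \<otimes> g \<in> H"
proof
  assume "x \<in> conj_subgroup G g H"
  then obtain h where "h \<in> H" "x = g \<otimes> h \<otimes> inv g"
    by (auto simp: conj_subgroup_def l_coset_def r_coset_def)
  thus "inv g \<otimes> x \<otimes> g \<in> H"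
    using assms subgroup.mem_carrier[OF assms(1)]
    by (simp add: m_assoc) (simp add: m_assoc[symmetric])
next
  assume "inv g \<otimes> x \<otimes> g \<in> H"
  moreover have "x = g \<otimes> (inv g \<otimes> x \<otimes> g) \<otimes> inv g"
    using assms by (simp add: m_assoc) (simp add: m_assoc[symmetric])
  ultimately show "x \<in> conj_subgroup G g H"
    unfolding conj_subgroup_def l_coset_def r_coset_def by blast
qed

lemma conj_subgroup_carrier:
  "H \<subseteq> carrier G \<Longrightarrow> g \<in> carrier G \<Longrightarrow> conj_subgroup G g H \<subseteq> carrier G"
  by (auto simp: conj_subgroup_def l_coset_def r_coset_def)

lemma conj_subgroup_eq_image:
  "conj_subgroup G g H = (\<lambda>h. g \<otimes> h \<otimes> inv g) ` H"
  by (auto simp: conj_subgroup_def l_coset_def r_coset_def)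

lemma card_conj_subgroup:
  assumes "H \<subseteq> carrier G" "g \<in> carrier G"
  shows "card (conj_subgroup G g H) = card H"
  unfolding conj_subgroup_eq_image
  by (rule card_image) (use assms in \<open>auto intro!: inj_onI simp: subset_iff\<close>)

lemma lcos_eq_iff:
  assumes "subgroup H G" "a \<in> carrier G" "b \<in> carrier G"
  shows "a <# H = b <# H \<longleftrightarrow> inv b \<otimes> a \<in> H"
proof
  assume "a <# H = b <# H"
  hence "a \<in> b <# H" using lcos_self[OF assms(2,1)] by simp
  then obtain h where "h \<in> H" "a = b \<otimes> h" by (auto simp: l_coset_def)
  thus "inv b \<otimes> a \<in> H" using assms subgroup.mem_carrier by (fastforce simp: m_assoc[symmetric])
next
  assume h: "inv b \<otimes> a \<in> H"
  have "a <# H = b <# ((inv b \<otimes> a) <# H)"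
    using assms subgroup.subset[OF assms(1)] by (simp add: lcos_m_assoc m_assoc[symmetric])
  also have "(inv b \<otimes> a) <# H = H" using coset_join3[OF _ assms(1) h] h assms by simp
  finally show "a <# H = b <# H" .
qed

lemma coset_action_lcos:
  assumes "subgroup H G" "g \<in> carrier G" "a \<in> carrier G"
  shows "coset_action G H g (a <# H) = (g \<otimes> a) <# H"
  using assms subgroup.subset[OF assms(1)]
  by (auto simp: coset_action_def lcosets_eq_image lcos_m_assoc)

lemma group_action_coset:
  assumes "subgroup H G"
  shows "group_action G (lcosets H) (coset_action G H)"
proof (rule group_actionI[OF is_group])
  show "coset_action G H g \<in> extensional (lcosets H)" for g by (simp add: coset_action_def)
  show "coset_action G H g C \<in> lcosets H" if "g \<in> carrier G" "C \<in> lcosets H" for g C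
    using that by (auto simp: lcosets_eq_image coset_action_lcos[OF assms])
  show "coset_action G H \<one> C = C" if "C \<in> lcosets H" for C
    using that by (auto simp: lcosets_eq_image coset_action_lcos[OF assms])
  show "coset_action G H (g \<otimes> h) C = coset_action G H g (coset_action G H h C)"
    if "g \<in> carrier G" "h \<in> carrier G" "C \<in> lcosets H" for g h C
    using that by (auto simp: lcosets_eq_image coset_action_lcos[OF assms] m_assoc)
qed

lemma stabilizer_lcos:
  assumes "subgroup H G" "a \<in> carrier G"
  shows "stabilizer G (coset_action G H) (a <# H) = conj_subgroup G a H"
proof -
  have "g \<in> stabilizer G (coset_action G H) (a <# H) \<longleftrightarrow> g \<in> conj_subgroup G a H"
    if "g \<in> carrier G" for g
    using that assms
    by (simp add: stabilizer_def coset_action_lcos lcos_eq_iff mem_conj_subgroup_iff m_assoc)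
  moreover have "conj_subgroup G a H \<subseteq> carrier G"
    using assms by (simp add: conj_subgroup_carrier subgroup.subset)
  ultimately show ?thesis by (auto simp: stabilizer_def)
qed

lemma conj_subgroup_one: "subgroup H G \<Longrightarrow> conj_subgroup G \<one> H = H"
  using mem_conj_subgroup_iff[of H \<one>] conj_subgroup_carrier[of H \<one>] subgroup.subset
  by (auto simp: subset_iff)

lemma orbit_lcos:
  assumes "subgroup H G" "C \<in> lcosets H"
  shows "orbit G (coset_action G H) C = lcosets H"
proof
  show "orbit G (coset_action G H) C \<subseteq> lcosets H"
    by (rule orbit_subset[OF group_action_coset[OF assms(1)] assms(2)])
  obtain a where a: "a \<in> carrier G" "C = a <# H" using assms by (auto simp: lcosets_eq_image)
  have "b <# H \<in> orbit G (coset_action G H) C" if "b \<in> carrier G" for b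
    unfolding orbit_def
    by (rule CollectI, rule exI[of _ "b \<otimes> inv a"])
      (use that a assms in \<open>simp add: coset_action_lcos m_assoc\<close>)
  thus "lcosets H \<subseteq> orbit G (coset_action G H) C" by (auto simp: lcosets_eq_image)
qed

lemma finite_lcosets: "finite (lcosets H)"
  using finite_carrier by (simp add: lcosets_eq_image)

lemma subgroup_mem_lcosets: "subgroup H G \<Longrightarrow> H \<in> lcosets H"
  using coset_join3[of \<one> H] subgroup.one_closed
  by (force simp: lcosets_eq_image)

lemma stabilizer_coset_self: "subgroup H G \<Longrightarrow> stabilizer G (coset_action G H) H = H"
  using stabilizer_lcos[of H \<one>] coset_join3[of \<one> H] subgroup.one_closed
  by (fastforce simp: conj_subgroup_one)

text \<open>
  Every orbit is the coset space of a stabilizer. Applied to the action on \<open>G/H\<close> itself, at the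
  point \<open>gH\<close>, this also shows that conjugate subgroups have the same basis mark.
\<close>

lemma mark_orbit:
  assumes "group_action G X \<phi>" "x \<in> X"
  shows "mark G (orbit G \<phi> x) \<phi> = basis_mark G (stabilizer G \<phi> x)"
proof -
  let ?H = "stabilizer G \<phi> x"
  have H: "subgroup ?H G" using group_action.stabilizer_subgroup[OF assms] .
  have "gset_iso G (orbit G \<phi> x) \<phi> (orbit G (coset_action G ?H) ?H) (coset_action G ?H)"
    using gset_iso_orbit[OF assms(1) group_action_coset[OF H] assms(2)
        subgroup_mem_lcosets[OF H]] stabilizer_coset_self[OF H] by simp
  thus ?thesis
    using mark_gset_iso[OF stable_orbit[OF assms]] orbit_lcos[OF H subgroup_mem_lcosets[OF H]]
    by (metis basis_mark_def)
qed

lemma basis_mark_conj: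
  assumes "subgroup H G" "g \<in> carrier G"
  shows "basis_mark G (conj_subgroup G g H) = basis_mark G H"
proof -
  have "g <# H \<in> lcosets H" using assms by (auto simp: lcosets_eq_image)
  from mark_orbit[OF group_action_coset[OF assms(1)] this] orbit_lcos[OF assms(1) this]
  show ?thesis using stabilizer_lcos[OF assms] by (simp add: basis_mark_def)
qed

lemma stabilizer_act:
  assumes "group_action G X \<phi>" "x \<in> X" "g \<in> carrier G" "k \<in> carrier G"
  shows "\<phi> (g \<otimes> k \<otimes> inv g) (\<phi> g x) = \<phi> g x \<longleftrightarrow> \<phi> k x = x"
proof -
  interpret A: group_action G X \<phi> by fact
  have "\<phi> (g \<otimes> k \<otimes> inv g) (\<phi> g x) = \<phi> (g \<otimes> k \<otimes> inv g \<otimes> g) x"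
    using assms A.composition_rule by simp
  also have "g \<otimes> k \<otimes> inv g \<otimes> g = g \<otimes> k" using assms by (simp add: m_assoc)
  also have "\<phi> (g \<otimes> k) x = \<phi> g (\<phi> k x)" using assms A.composition_rule by simp
  finally show ?thesis
    using A.inj_prop[OF assms(3)] assms group_action_closed by (metis inj_onD)
qed

lemma mark_conj:
  assumes "group_action G X \<phi>" "g \<in> carrier G" "K \<subseteq> carrier G"
  shows "mark G X \<phi> (conj_subgroup G g K) = mark G X \<phi> K"
proof -
  interpret A: group_action G X \<phi> by fact
  have sub: "conj_subgroup G g K \<subseteq> carrier G" using conj_subgroup_carrier assms by simp
  have *: "\<phi> g x \<in> fixed_points G X \<phi> (conj_subgroup G g K) \<longleftrightarrow> x \<in> fixed_points G X \<phi> K"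
    if "x \<in> X" for x
    using that assms sub group_action_closed[OF assms(1)] stabilizer_act[OF assms(1) that assms(2)]
    by (simp add: fixed_points_def Int_absorb2 conj_subgroup_eq_image subset_iff)
  have "\<phi> g ` fixed_points G X \<phi> K = fixed_points G X \<phi> (conj_subgroup G g K)"
  proof
    show "\<phi> g ` fixed_points G X \<phi> K \<subseteq> fixed_points G X \<phi> (conj_subgroup G g K)"
      using * by (auto simp: fixed_points_def)
    show "fixed_points G X \<phi> (conj_subgroup G g K) \<subseteq> \<phi> g ` fixed_points G X \<phi> K"
    proof
      fix y assume y: "y \<in> fixed_points G X \<phi> (conj_subgroup G g K)"
      hence "y \<in> \<phi> g ` X" using A.surj_prop[OF assms(2)] by (simp add: fixed_points_def)
      thus "y \<in> \<phi> g ` fixed_points G X \<phi> K" using * y by auto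
    qed
  qed
  moreover have "inj_on (\<phi> g) (fixed_points G X \<phi> K)"
    by (rule inj_on_subset[OF A.inj_prop[OF assms(2)]]) (auto simp: fixed_points_def)
  ultimately show ?thesis unfolding mark_def by (metis card_image)
qed

lemma basis_mark_nonzero_iff:
  assumes "subgroup F G"
  shows "basis_mark G F K \<noteq> 0 \<longleftrightarrow> (\<exists>g \<in> carrier G. K \<inter> carrier G \<subseteq> conj_subgroup G g F)"
  unfolding basis_mark_def mark_nonzero_iff[OF finite_lcosets]
  using stabilizer_lcos[OF assms] by (auto simp: lcosets_eq_image)

end

section \<open>Integral combinations of marks of cosets\<close>

definition mark_span :: "('g, 'm) monoid_scheme \<Rightarrow> 'g set set \<Rightarrow> ('g set \<Rightarrow> int) set" where
  "mark_span G \<E> = {(\<lambda>K. \<Sum>F\<in>\<E>. a F * basis_mark G F K) | a. True}"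

lemma mark_span_zero: "0 \<in> mark_span G \<E>"
  unfolding mark_span_def by (rule CollectI, rule exI[of _ "\<lambda>_. 0"]) (auto simp: zero_fun_def)

lemma mark_span_add:
  assumes "f \<in> mark_span G \<E>" "g \<in> mark_span G \<E>"
  shows "f + g \<in> mark_span G \<E>"
proof -
  obtain a b where "f = (\<lambda>K. \<Sum>F\<in>\<E>. a F * basis_mark G F K)"
    "g = (\<lambda>K. \<Sum>F\<in>\<E>. b F * basis_mark G F K)" using assms by (auto simp: mark_span_def)
  hence "f + g = (\<lambda>K. \<Sum>F\<in>\<E>. (a F + b F) * basis_mark G F K)"
    by (auto simp: plus_fun_def algebra_simps sum.distrib)
  thus ?thesis by (auto simp: mark_span_def)
qed

lemma mark_span_scale:
  assumes "f \<in> mark_span G \<E>"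
  shows "(\<lambda>K. c * f K) \<in> mark_span G \<E>"
proof -
  obtain a where "f = (\<lambda>K. \<Sum>F\<in>\<E>. a F * basis_mark G F K)"
    using assms by (auto simp: mark_span_def)
  hence "(\<lambda>K. c * f K) = (\<lambda>K. \<Sum>F\<in>\<E>. (c * a F) * basis_mark G F K)"
    by (auto simp: sum_distrib_left mult.assoc)
  thus ?thesis by (auto simp: mark_span_def)
qed

lemma mark_span_uminus: "f \<in> mark_span G \<E> \<Longrightarrow> - f \<in> mark_span G \<E>"
  using mark_span_scale[of f G \<E> "-1"] by (simp add: fun_Compl_def)

lemma mark_span_diff: "f \<in> mark_span G \<E> \<Longrightarrow> g \<in> mark_span G \<E> \<Longrightarrow> f - g \<in> mark_span G \<E>"
  using mark_span_add[OF _ mark_span_uminus] by force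

lemma mark_span_sum:
  assumes "\<And>i. i \<in> I \<Longrightarrow> f i \<in> mark_span G \<E>"
  shows "(\<Sum>i\<in>I. f i) \<in> mark_span G \<E>"
  using assms
proof (induction I rule: infinite_finite_induct)
  case (insert i I)
  show ?case
    unfolding sum.insert[OF insert.hyps] by (intro mark_span_add insert.IH insert.prems) auto
qed (simp_all add: mark_span_zero)

lemma sum_fun_apply: "(\<Sum>i\<in>I. f i) x = (\<Sum>i\<in>I. f i x)"
  by (induction I rule: infinite_finite_induct) auto

lemma prod_fun_apply: "(\<Prod>i\<in>I. f i) x = (\<Prod>i\<in>I. f i x)"
  by (induction I rule: infinite_finite_induct) auto

lemma mark_span_lincomb:
  assumes "\<And>i. i \<in> I \<Longrightarrow> h i \<in> mark_span G \<E>"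
  shows "(\<lambda>K. \<Sum>i\<in>I. c i * h i K) \<in> mark_span G \<E>"
proof -
  have "(\<lambda>K. \<Sum>i\<in>I. c i * h i K) = (\<Sum>i\<in>I. (\<lambda>K. c i * h i K))"
    by (rule ext) (simp only: sum_fun_apply)
  also have "\<dots> \<in> mark_span G \<E>" by (intro mark_span_sum mark_span_scale assms)
  finally show ?thesis .
qed

lemma basis_mark_in_span:
  assumes "finite \<E>" "F \<in> \<E>"
  shows "basis_mark G F \<in> mark_span G \<E>"
proof -
  have "basis_mark G F = (\<lambda>K. \<Sum>F'\<in>\<E>. (if F' = F then 1 else 0) * basis_mark G F' K)"
  proof
    fix K
    have "(\<Sum>F'\<in>\<E>. (if F' = F then 1 else 0) * basis_mark G F' K)
        = (\<Sum>F'\<in>\<E>. if F' = F then basis_mark G F' K else 0)"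
      by (rule sum.cong) auto
    thus "basis_mark G F K = (\<Sum>F'\<in>\<E>. (if F' = F then 1 else 0) * basis_mark G F' K)"
      using assms by (simp add: sum.delta)
  qed
  thus ?thesis by (auto simp: mark_span_def)
qed

lemma mark_span_mono:
  assumes "finite \<E>" "\<E>' \<subseteq> \<E>"
  shows "mark_span G \<E>' \<subseteq> mark_span G \<E>"
proof
  fix f assume "f \<in> mark_span G \<E>'"
  then obtain a where "f = (\<lambda>K. \<Sum>F\<in>\<E>'. a F * basis_mark G F K)"
    by (auto simp: mark_span_def)
  moreover have "(\<lambda>K. \<Sum>F\<in>\<E>'. a F * basis_mark G F K) \<in> mark_span G \<E>"
    using assms by (intro mark_span_lincomb basis_mark_in_span) auto
  ultimately show "f \<in> mark_span G \<E>" by simp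
qed

text \<open>
  The span is the additive subgroup generated by the basis marks: integer multiples are repeated sums
  and negatives.
\<close>

lemma mark_span_least:
  assumes zero: "0 \<in> Z" and add: "\<And>f g. f \<in> Z \<Longrightarrow> g \<in> Z \<Longrightarrow> f + g \<in> Z"
    and uminus: "\<And>f. f \<in> Z \<Longrightarrow> - f \<in> Z" and basis: "\<And>F. F \<in> \<E> \<Longrightarrow> basis_mark G F \<in> Z"
  shows "mark_span G \<E> \<subseteq> Z"
proof
  fix f assume "f \<in> mark_span G \<E>"
  then obtain a where f: "f = (\<lambda>K. \<Sum>F\<in>\<E>. a F * basis_mark G F K)"
    by (auto simp: mark_span_def)
  have nat: "(\<lambda>K. int n * h K) \<in> Z" if "h \<in> Z" for h n
  proof (induction n)
    case 0
    have "(\<lambda>K. int 0 * h K) = 0" by (simp add: fun_eq_iff)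
    thus ?case using zero by metis
  next
    case (Suc n)
    have "(\<lambda>K. int (Suc n) * h K) = (\<lambda>K. int n * h K) + h" by (simp add: fun_eq_iff algebra_simps)
    thus ?case using add[OF Suc that] by metis
  qed
  have scale: "(\<lambda>K. c * h K) \<in> Z" if "h \<in> Z" for h c
  proof (cases c)
    case (nonneg n)
    thus ?thesis using nat[OF that] by simp
  next
    case (neg n)
    hence "(\<lambda>K. c * h K) = - (\<lambda>K. int (Suc n) * h K)"
      by (simp only: fun_Compl_def mult_minus_left)
    thus ?thesis using uminus[OF nat[OF that, of "Suc n"]] by (simp only:)
  qed
  have "(\<Sum>F\<in>\<A>. (\<lambda>K. a F * basis_mark G F K)) \<in> Z" if "\<A> \<subseteq> \<E>" for \<A>
    using that
  proof (induction \<A> rule: infinite_finite_induct)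
    case (insert F \<A>)
    show ?case unfolding sum.insert[OF insert.hyps]
    proof (rule add)
      show "(\<lambda>K. a F * basis_mark G F K) \<in> Z" using insert.prems by (intro scale basis) simp
      show "(\<Sum>F\<in>\<A>. (\<lambda>K. a F * basis_mark G F K)) \<in> Z" using insert.prems by (intro insert.IH) simp
    qed
  next
    case (infinite \<A>)
    show ?case unfolding sum.infinite[OF infinite.hyps] by (rule zero)
  next
    case empty
    show ?case unfolding sum.empty by (rule zero)
  qed
  moreover have "f = (\<Sum>F\<in>\<E>. (\<lambda>K. a F * basis_mark G F K))"
    unfolding f by (rule ext) (simp only: sum_fun_apply)
  ultimately show "f \<in> Z" by simp
qed

lemma prod_action_apply:
  "x \<in> X \<Longrightarrow> y \<in> Y \<Longrightarrow> prod_action X \<phi> Y \<psi> g (x, y) = (\<phi> g x, \<psi> g y)"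
  by (simp add: prod_action_def)

lemma group_action_prod:
  assumes "group_action G X \<phi>" "group_action G Y \<psi>"
  shows "group_action G (X \<times> Y) (prod_action X \<phi> Y \<psi>)"
proof (rule group_actionI)
  show "group G" by (rule action_group[OF assms(1)])
qed (auto simp: prod_action_apply group_action_one[OF assms(1)] group_action_one[OF assms(2)]
    group_action_closed[OF assms(1)] group_action_closed[OF assms(2)]
    group_action.composition_rule[OF assms(1)] group_action.composition_rule[OF assms(2)],
    simp add: prod_action_def)

lemma mark_prod_action: "mark G (X \<times> Y) (prod_action X \<phi> Y \<psi>) = mark G X \<phi> * mark G Y \<psi>"
proof
  fix K
  have "fixed_points G (X \<times> Y) (prod_action X \<phi> Y \<psi>) K
      = fixed_points G X \<phi> K \<times> fixed_points G Y \<psi> K"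
    by (auto simp: fixed_points_def prod_action_def)
  thus "mark G (X \<times> Y) (prod_action X \<phi> Y \<psi>) K = (mark G X \<phi> * mark G Y \<psi>) K"
    by (simp add: mark_def card_cartesian_product)
qed

context finite_group
begin

lemma closed_family_finite: "closed_family G \<E> \<Longrightarrow> finite \<E>"
  by (rule finite_subset[of _ "Pow (carrier G)"])
    (auto simp: closed_family_def finite_carrier dest: subgroup.subset)

text \<open>
  Decomposition into orbits: removing the orbit of a point \<open>x\<close> subtracts the basis mark of its
  stabilizer.
\<close>

lemma mark_in_span:
  assumes X: "group_action G X \<phi>" and "finite \<E>"
    and "U \<subseteq> X" "action_stable G \<phi> U" "finite U" "\<And>x. x \<in> U \<Longrightarrow> stabilizer G \<phi> x \<in> \<E>"
  shows "mark G U \<phi> \<in> mark_span G \<E>"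
  using assms(3-)
proof (induction "card U" arbitrary: U rule: less_induct)
  case less
  show ?case
  proof (cases "U = {}")
    case True
    hence "mark G U \<phi> = 0" by (simp add: fun_eq_iff mark_def fixed_points_def)
    thus ?thesis using mark_span_zero by metis
  next
    case False
    then obtain x where x: "x \<in> U" by blast
    let ?O = "orbit G \<phi> x"
    have xX: "x \<in> X" and O: "?O \<subseteq> U"
      using x less.prems(1) orbit_subset_stable[OF less.prems(2) x] by auto
    have "card (U - ?O) < card U"
      using x less.prems(3) orbit_self[OF X xX] by (intro psubset_card_mono) auto
    hence "mark G (U - ?O) \<phi> \<in> mark_span G \<E>"
      using less.prems x stable_Diff_orbit[OF X] by (intro less.hyps) auto
    moreover have "mark G ?O \<phi> \<in> mark_span G \<E>"
      using mark_orbit[OF X xX] basis_mark_in_span[OF assms(2) less.prems(4)[OF x]] by simp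
    moreover have "mark G U \<phi> = mark G ?O \<phi> + mark G (U - ?O) \<phi>"
      using mark_disjoint_Un[of ?O "U - ?O" G \<phi>] O less.prems(3)
      by (metis Diff_disjoint Un_Diff_cancel Un_absorb1 finite_Diff finite_subset)
    ultimately show ?thesis using mark_span_add by metis
  qed
qed

text \<open>
  The product of two basis marks is the mark of \<open>G/F \<times> G/F'\<close>, where stabilizers are
  intersections \<open>gFg\<^sup>-\<^sup>1 \<inter> hF'h\<^sup>-\<^sup>1\<close>; these belong to a closed family containing \<open>F\<close> and \<open>F'\<close>.
\<close>

lemma basis_mark_mult_in_span:
  assumes "closed_family G \<E>" "F \<in> \<E>" "F' \<in> \<E>"
  shows "basis_mark G F * basis_mark G F' \<in> mark_span G \<E>"
proof -
  have sub: "subgroup F G" "subgroup F' G" using assms by (auto simp: closed_family_def)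
  let ?A = "coset_action G F" and ?B = "coset_action G F'"
  let ?X = "(lcosets F) \<times> (lcosets F')" and ?\<phi> = "prod_action (lcosets F) ?A (lcosets F') ?B"
  have act: "group_action G ?X ?\<phi>" by (intro group_action_prod group_action_coset sub)
  have "stabilizer G ?\<phi> z \<in> \<E>" if z: "z \<in> ?X" for z
  proof -
    obtain a b where ab: "a \<in> carrier G" "b \<in> carrier G" "z = (a <# F, b <# F')"
      using z by (auto simp: lcosets_eq_image)
    have "stabilizer G ?\<phi> z = stabilizer G ?A (a <# F) \<inter> stabilizer G ?B (b <# F')"
      using z ab by (auto simp: stabilizer_def prod_action_apply)
    thus ?thesis
      using assms ab sub by (simp add: stabilizer_lcos closed_family_def)
  qed
  from mark_in_span[OF act closed_family_finite[OF assms(1)] order_refl stable_action[OF act] _ this]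
  show ?thesis by (simp add: mark_prod_action basis_mark_def finite_lcosets)
qed

lemma mark_span_mult:
  assumes "closed_family G \<E>" "f \<in> mark_span G \<E>" "g \<in> mark_span G \<E>"
  shows "f * g \<in> mark_span G \<E>"
proof -
  obtain a b where f: "f = (\<lambda>K. \<Sum>F\<in>\<E>. a F * basis_mark G F K)" and
    g: "g = (\<lambda>K. \<Sum>F\<in>\<E>. b F * basis_mark G F K)" using assms by (auto simp: mark_span_def)
  have *: "f * basis_mark G F' \<in> mark_span G \<E>" if "F' \<in> \<E>" for F'
  proof -
    have "f * basis_mark G F' = (\<lambda>K. \<Sum>F\<in>\<E>. a F * (basis_mark G F * basis_mark G F') K)"
      by (simp add: f fun_eq_iff sum_distrib_right mult.assoc)
    thus ?thesis
      using mark_span_lincomb[of \<E> "\<lambda>F. basis_mark G F * basis_mark G F'" G \<E> a]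
        basis_mark_mult_in_span[OF assms(1) _ that] by simp
  qed
  have "f * g = (\<lambda>K. \<Sum>F'\<in>\<E>. b F' * (f * basis_mark G F') K)"
    by (simp add: g fun_eq_iff sum_distrib_left mult_ac)
  thus ?thesis using mark_span_lincomb[of \<E> "\<lambda>F. f * basis_mark G F" G \<E> b] * by simp
qed

lemma basis_mark_carrier: "basis_mark G (carrier G) = 1"
proof
  fix K
  have "a <# carrier G = carrier G" if "a \<in> carrier G" for a
    using coset_join3[OF that subgroup_self that] .
  hence "lcosets (carrier G) = {carrier G}" by (auto simp: lcosets_eq_image)
  moreover from this have "fixed_points G (lcosets (carrier G)) (coset_action G (carrier G)) K
      = {carrier G}"
    using group_action_closed[OF group_action_coset[OF subgroup_self]]
    by (auto simp: fixed_points_def)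
  ultimately show "basis_mark G (carrier G) K = 1 K" by (simp add: basis_mark_def mark_def)
qed

lemma one_in_mark_span: "finite \<D> \<Longrightarrow> carrier G \<in> \<D> \<Longrightarrow> 1 \<in> mark_span G \<D>"
  using basis_mark_in_span basis_mark_carrier by metis

lemma mark_span_conj:
  assumes "\<forall>F\<in>\<E>. subgroup F G" "f \<in> mark_span G \<E>" "g \<in> carrier G" "K \<subseteq> carrier G"
  shows "f (conj_subgroup G g K) = f K"
proof -
  obtain a where f: "f = (\<lambda>K. \<Sum>F\<in>\<E>. a F * basis_mark G F K)"
    using assms by (auto simp: mark_span_def)
  have "basis_mark G F (conj_subgroup G g K) = basis_mark G F K" if "F \<in> \<E>" for F
    unfolding basis_mark_def using assms that by (intro mark_conj group_action_coset) auto
  thus ?thesis by (simp add: f)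
qed

text \<open>
  The coset \<open>gF\<close> is fixed by \<open>K\<close> exactly if \<open>K\<close> is contained in \<open>gFg\<^sup>-\<^sup>1\<close>. As this is a member of the
  family, containing \<open>K\<close> is the same as containing the intersection of all members above \<open>K\<close>.
\<close>

lemma basis_mark_closure:
  assumes "closed_family G \<E>" "F \<in> \<E>"
  shows "basis_mark G F K = (if \<exists>E\<in>\<E>. K \<inter> carrier G \<subseteq> E
     then basis_mark G F (\<Inter>{E \<in> \<E>. K \<inter> carrier G \<subseteq> E}) else 0)"
proof -
  let ?L = "\<Inter>{E \<in> \<E>. K \<inter> carrier G \<subseteq> E}"
  have F: "subgroup F G" using assms by (auto simp: closed_family_def)
  have conj: "conj_subgroup G g F \<in> \<E>" if "g \<in> carrier G" for g
    using assms that by (auto simp: closed_family_def)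
  show ?thesis
  proof (cases "\<exists>E\<in>\<E>. K \<inter> carrier G \<subseteq> E")
    case False
    thus ?thesis using basis_mark_nonzero_iff[OF F, of K] conj by auto
  next
    case True
    then obtain E where E: "E \<in> \<E>" "K \<inter> carrier G \<subseteq> E" by blast
    have "subgroup E G" using E assms by (auto simp: closed_family_def)
    hence L: "?L \<subseteq> carrier G" using E subgroup.subset by blast
    have "K \<inter> carrier G \<subseteq> conj_subgroup G g F \<longleftrightarrow> ?L \<inter> carrier G \<subseteq> conj_subgroup G g F"
      if "g \<in> carrier G" for g
      using conj[OF that] L by blast
    hence "K \<inter> carrier G \<subseteq> stabilizer G (coset_action G F) C
        \<longleftrightarrow> ?L \<inter> carrier G \<subseteq> stabilizer G (coset_action G F) C" if "C \<in> lcosets F" for C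
      using that stabilizer_lcos[OF F] unfolding lcosets_eq_image by force
    hence "fixed_points G (lcosets F) (coset_action G F) K
        = fixed_points G (lcosets F) (coset_action G F) ?L"
      unfolding set_eq_iff fixed_points_iff_stabilizer by blast
    thus ?thesis using True by (simp add: basis_mark_def mark_def)
  qed
qed

lemma Inter_closed_family:
  assumes "closed_family G \<E>" "\<A> \<subseteq> \<E>" "\<A> \<noteq> {}"
  shows "\<Inter>\<A> \<in> \<E>"
proof -
  have "finite \<A>" using assms closed_family_finite finite_subset by blast
  thus ?thesis using assms(3,2)
  proof (induction rule: finite_ne_induct)
    case (insert A \<A>)
    thus ?case using assms(1) by (simp add: closed_family_def)
  qed simp
qed

lemma mark_span_closure:
  assumes "closed_family G \<E>"
  shows "(\<forall>f \<in> mark_span G \<E>. f K = 0) \<or> (\<exists>E\<in>\<E>. \<forall>f \<in> mark_span G \<E>. f K = f E)"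
proof (cases "\<exists>E\<in>\<E>. K \<inter> carrier G \<subseteq> E")
  case False
  hence "f K = 0" if "f \<in> mark_span G \<E>" for f
    using that basis_mark_closure[OF assms, of _ K] by (auto simp: mark_span_def)
  thus ?thesis by blast
next
  case True
  let ?L = "\<Inter>{E \<in> \<E>. K \<inter> carrier G \<subseteq> E}"
  have "?L \<in> \<E>" using True by (intro Inter_closed_family[OF assms]) auto
  moreover have "f K = f ?L" if "f \<in> mark_span G \<E>" for f
    using that basis_mark_closure[OF assms, of _ K] True by (auto simp: mark_span_def)
  ultimately show ?thesis by blast
qed

text \<open>
  The possible value 0 in \<open>A\<close> covers those \<open>K\<close> that lie in no member of the family.
\<close>

lemma mark_span_values:
  assumes "closed_family G \<E>" "f \<in> mark_span G \<E>" "0 \<in> A" "\<And>E. E \<in> \<E> \<Longrightarrow> f E \<in> A"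
  shows "f K \<in> A"
  using mark_span_closure[OF assms(1), of K] assms(2-) by auto

lemma mark_span_carrier:
  assumes "f \<in> mark_span G \<E>"
  shows "f (K \<inter> carrier G) = f K"
  using assms by (auto simp: mark_span_def basis_mark_def mark_def fixed_points_def)

lemma normal_subset_conj_iff:
  assumes "subgroup F G" "H \<lhd> G" "g \<in> carrier G"
  shows "H \<subseteq> conj_subgroup G g F \<longleftrightarrow> H \<subseteq> F"
proof -
  have Hs: "H \<subseteq> carrier G" using normal_imp_subgroup[OF assms(2)] subgroup.subset by blast
  have "inv g \<otimes> h \<otimes> g \<in> H" "g \<otimes> h \<otimes> inv g \<in> H" if "h \<in> H" for h
    using normal.inv_op_closed1[OF assms(2,3) that] normal.inv_op_closed2[OF assms(2,3) that]
    by auto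
  moreover have "h = inv g \<otimes> (g \<otimes> h \<otimes> inv g) \<otimes> g" if "h \<in> H" for h
    using that assms(3) Hs by (auto simp: m_assoc subset_iff) (auto simp: m_assoc[symmetric] subset_iff)
  ultimately show ?thesis
    using mem_conj_subgroup_iff[OF assms(1,3)] Hs by (metis subset_iff)
qed

text \<open>
  A normal subgroup \<open>H\<close> fixes either all cosets of \<open>F\<close> or none, as all stabilizers are conjugate.
\<close>

lemma basis_mark_Un_normal:
  assumes "subgroup F G" "H \<lhd> G"
  shows "basis_mark G F (K \<union> H) = (if H \<subseteq> F then basis_mark G F K else 0)"
proof -
  have Hs: "H \<subseteq> carrier G" using normal_imp_subgroup[OF assms(2)] subgroup.subset by blast
  note H = normal_subset_conj_iff[OF assms]
  have "(K \<union> H) \<inter> carrier G \<subseteq> stabilizer G (coset_action G F) C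
      \<longleftrightarrow> H \<subseteq> F \<and> K \<inter> carrier G \<subseteq> stabilizer G (coset_action G F) C" if C: "C \<in> lcosets F" for C
  proof -
    obtain g where "g \<in> carrier G" "C = g <# F" using C by (auto simp: lcosets_eq_image)
    moreover have "(K \<union> H) \<inter> carrier G = K \<inter> carrier G \<union> H" using Hs by auto
    ultimately show ?thesis using stabilizer_lcos[OF assms(1)] H by auto
  qed
  hence "fixed_points G (lcosets F) (coset_action G F) (K \<union> H)
     = (if H \<subseteq> F then fixed_points G (lcosets F) (coset_action G F) K else {})"
    unfolding set_eq_iff by (auto simp: fixed_points_iff_stabilizer)
  thus ?thesis by (simp add: basis_mark_def mark_def)
qed

end

section \<open>The grading by the basic collection and units among mark functions\<close>

definition mark_bar :: "('g, 'm) monoid_scheme \<Rightarrow> 'g set set \<Rightarrow> ('g set \<Rightarrow> int) set" where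
  "mark_bar G \<E> = {f \<in> mark_span G \<E>. f * f + (f + f) = 0}"

text \<open>
  An invertible integer is its own inverse, so these are the invertible functions in the span.
\<close>

definition mark_units :: "('g, 'm) monoid_scheme \<Rightarrow> 'g set set \<Rightarrow> ('g set \<Rightarrow> int) set" where
  "mark_units G \<D> = {f \<in> mark_span G \<D>. f * f = 1}"

text \<open>
  For a normal subgroup \<open>H\<close> this is the map induced by \<open>X \<mapsto> X\<^sup>H\<close>: the points of \<open>X\<^sup>H\<close> that \<open>K\<close> fixes
  are the points of \<open>X\<close> that \<open>K \<union> H\<close> fixes. As a substitution it is a ring endomorphism.
\<close>

definition fixed_part :: "'g set \<Rightarrow> ('g set \<Rightarrow> int) \<Rightarrow> 'g set \<Rightarrow> int" where
  "fixed_part H f = (\<lambda>K. f (K \<union> H))"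

lemma fixed_part_add [simp]: "fixed_part H (f + g) = fixed_part H f + fixed_part H g"
  by (auto simp: fixed_part_def)

lemma fixed_part_diff [simp]: "fixed_part H (f - g) = fixed_part H f - fixed_part H g"
  by (auto simp: fixed_part_def)

lemma fixed_part_mult [simp]: "fixed_part H (f * g) = fixed_part H f * fixed_part H g"
  by (auto simp: fixed_part_def)

lemma fixed_part_one [simp]: "fixed_part H 1 = 1"
  by (auto simp: fixed_part_def)

lemma fixed_part_sum: "fixed_part H (\<Sum>i\<in>I. f i) = (\<Sum>i\<in>I. fixed_part H (f i))"
  by (rule ext) (simp add: fixed_part_def sum_fun_apply)

lemma fixed_part_prod: "fixed_part H (\<Prod>i\<in>I. f i) = (\<Prod>i\<in>I. fixed_part H (f i))"
  by (rule ext) (simp add: fixed_part_def prod_fun_apply)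

lemma fixed_part_fixed_part: "H \<subseteq> L \<Longrightarrow> fixed_part L (fixed_part H f) = fixed_part L f"
  by (auto simp: fixed_part_def Un_assoc Un_absorb2)

lemma bar_square_one:
  fixes f :: "'a :: comm_ring_1"
  shows "f * f + (f + f) = 0 \<longleftrightarrow> (1 + f) * (1 + f) = 1"
proof -
  have "(1 + f) * (1 + f) = 1 + (f * f + (f + f))" by (simp add: algebra_simps)
  thus ?thesis by simp
qed

lemma mark_bar_square: "f \<in> mark_bar G \<E> \<Longrightarrow> (1 + f) * (1 + f) = 1"
  unfolding mark_bar_def using bar_square_one[of f] by blast

lemma mark_bar_iff:
  "f \<in> mark_bar G \<E> \<longleftrightarrow> f \<in> mark_span G \<E> \<and> (\<forall>K. f K \<in> {0, -2})"
proof -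
  have "x * x + (x + x) = 0 \<longleftrightarrow> x \<in> {0, -2}" for x :: int
  proof -
    have "x * x + (x + x) = x * (x + 2)" by (simp add: algebra_simps)
    thus ?thesis by auto
  qed
  thus ?thesis by (auto simp: mark_bar_def fun_eq_iff)
qed

context finite_group
begin

text \<open>
  A member is a function into \<open>{0, -2}\<close> and is determined by its values on the subsets of the
  finite group \<open>G\<close>.
\<close>

lemma finite_mark_bar: "finite (mark_bar G \<E>)"
proof (rule finite_subset)
  let ?P = "Pow (carrier G) \<rightarrow>\<^sub>E {0 :: int, -2}"
  show "finite ((\<lambda>g K. g (K \<inter> carrier G)) ` ?P)"
    using finite_carrier by (intro finite_imageI finite_PiE) auto
  show "mark_bar G \<E> \<subseteq> (\<lambda>g K. g (K \<inter> carrier G)) ` ?P"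
  proof
    fix f assume f: "f \<in> mark_bar G \<E>"
    have "f = (\<lambda>K. restrict f (Pow (carrier G)) (K \<inter> carrier G))"
      using f mark_span_carrier[of f \<E>] by (auto simp: mark_bar_def)
    moreover have "restrict f (Pow (carrier G)) \<in> ?P" using f by (auto simp: mark_bar_iff)
    ultimately show "f \<in> (\<lambda>g K. g (K \<inter> carrier G)) ` ?P" by blast
  qed
qed

end

locale graded_collection = finite_group +
  fixes \<D> S :: "'a set set"
  assumes collection: "collection G \<D>" and basic: "basic_collection G S"
begin

abbreviation fam :: "'a set \<Rightarrow> 'a set set" where
  "fam \<equiv> S_family \<D> S"

lemma closed_D: "closed_family G \<D>" and carrier_D: "carrier G \<in> \<D>"
  using collection by (auto simp: collection_def)

lemma finite_D: "finite \<D>"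
  using closed_family_finite[OF closed_D] .

lemma finite_S: "finite S"
  using basic closed_family_finite by (simp add: basic_collection_def collection_def)

lemma normal_S: "H \<in> S \<Longrightarrow> H \<lhd> G"
  using basic by (simp add: basic_collection_def)

lemma subset_S: "H \<in> S \<Longrightarrow> H \<subseteq> carrier G"
  using normal_S normal_imp_subgroup subgroup.subset by blast

lemma subgroup_D: "F \<in> \<D> \<Longrightarrow> subgroup F G"
  using closed_D by (simp add: closed_family_def)

lemma fam_subset: "fam H \<subseteq> \<D>"
  by (auto simp: S_family_def)

text \<open>
  \<open>H\<close> is the largest member of \<open>S\<close> below \<open>F\<close>: with \<open>K \<subseteq> F\<close> also \<open>HK \<in> S\<close> lies between \<open>H\<close> and \<open>F\<close>, so
  \<open>H = HK\<close>.
\<close>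

lemma fam_core:
  assumes "F \<in> fam H" "H \<in> S" "K \<in> S"
  shows "K \<subseteq> F \<longleftrightarrow> K \<subseteq> H"
proof
  assume KF: "K \<subseteq> F"
  have sub: "subgroup H G" "subgroup K G" "subgroup F G"
    using assms normal_S normal_imp_subgroup subgroup_D fam_subset by blast+
  have "H <#> K \<in> S" using basic assms by (simp add: basic_collection_def)
  moreover have "H \<subseteq> H <#> K"
    using subgroup.one_closed[OF sub(2)] subset_S[OF assms(2)]
    by (force simp: set_mult_def)
  moreover have K: "K \<subseteq> H <#> K"
    using subgroup.one_closed[OF sub(1)] subset_S[OF assms(3)]
    by (force simp: set_mult_def)
  moreover have "H <#> K \<subseteq> F"
    using KF assms(1) subgroup.m_closed[OF sub(3)] by (auto simp: set_mult_def S_family_def)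
  ultimately have "H = H <#> K" using assms(1) by (auto simp: S_family_def)
  thus "K \<subseteq> H" using K by simp
next
  assume "K \<subseteq> H" thus "K \<subseteq> F" using assms(1) by (auto simp: S_family_def)
qed

text \<open>
  The core of \<open>F\<close> is found as a member of \<open>S\<close> of maximal order among those contained in \<open>F\<close>.
\<close>

lemma fam_cover:
  assumes "F \<in> \<D>"
  obtains H where "H \<in> S" "F \<in> fam H"
proof -
  let ?A = "{H \<in> S. H \<subseteq> F}"
  have fin: "finite ?A" using finite_S by simp
  have "{\<one>} \<in> ?A"
    using basic subgroup.one_closed[OF subgroup_D[OF assms]] by (simp add: basic_collection_def)
  hence "Max (card ` ?A) \<in> card ` ?A" using fin by (intro Max_in) auto
  then obtain H where H: "H \<in> ?A" and m: "card H = Max (card ` ?A)" by auto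
  have "H = H'" if "H' \<in> S" "H \<subseteq> H'" "H' \<subseteq> F" for H'
  proof -
    have "card H' \<le> card H" using that fin m by simp
    moreover have "finite H'" using subset_S[OF that(1)] finite_carrier finite_subset by blast
    ultimately show ?thesis using that(2) card_seteq by blast
  qed
  hence "F \<in> fam H" using H assms by (auto simp: S_family_def)
  thus ?thesis using H that by blast
qed

lemma fam_disjoint: "H \<in> S \<Longrightarrow> K \<in> S \<Longrightarrow> H \<noteq> K \<Longrightarrow> fam H \<inter> fam K = {}"
  using fam_core by blast

lemma D_eq_UN_fam: "\<D> = (\<Union>H\<in>S. fam H)"
  using fam_cover fam_subset by blast

lemma closed_fam:
  assumes "H \<in> S"
  shows "closed_family G (fam H)"
  unfolding closed_family_def
proof (intro conjI ballI)
  show "subgroup F G" if "F \<in> fam H" for F using that fam_subset subgroup_D by blast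
  show "F \<inter> F' \<in> fam H" if "F \<in> fam H" "F' \<in> fam H" for F F'
    using that closed_D by (auto simp: S_family_def closed_family_def)
  show "conj_subgroup G g F \<in> fam H" if "F \<in> fam H" "g \<in> carrier G" for F g
  proof -
    have F: "F \<in> \<D>" using that fam_subset by blast
    have "K \<subseteq> conj_subgroup G g F \<longleftrightarrow> K \<subseteq> F" if "K \<in> S" for K
      using normal_subset_conj_iff[OF subgroup_D[OF F] normal_S[OF that] \<open>g \<in> carrier G\<close>] .
    moreover have "conj_subgroup G g F \<in> \<D>" using closed_D F that by (simp add: closed_family_def)
    ultimately show ?thesis using that(1) assms by (auto simp: S_family_def)
  qed
qed

lemma fixed_part_span:
  assumes "H \<in> S" "f \<in> mark_span G \<D>"
  shows "fixed_part H f \<in> mark_span G \<D>"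
proof -
  obtain a where f: "f = (\<lambda>K. \<Sum>F\<in>\<D>. a F * basis_mark G F K)"
    using assms by (auto simp: mark_span_def)
  have "fixed_part H f = (\<lambda>K. \<Sum>F\<in>\<D>. (if H \<subseteq> F then a F else 0) * basis_mark G F K)"
    unfolding f fixed_part_def
    by (intro ext sum.cong) (auto simp: basis_mark_Un_normal[OF subgroup_D normal_S[OF assms(1)]])
  thus ?thesis by (auto simp: mark_span_def)
qed

text \<open>
  On the piece of index \<open>M\<close>, the condition \<open>H \<subseteq> F\<close> that decides whether the basis mark of \<open>F\<close>
  survives is \<open>H \<subseteq> M\<close> for all \<open>F\<close> at once.
\<close>

lemma fixed_part_fam:
  assumes "H \<in> S" "M \<in> S" "f \<in> mark_span G (fam M)"
  shows "fixed_part H f = (if H \<subseteq> M then f else 0)"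
proof -
  obtain a where f: "f = (\<lambda>K. \<Sum>F\<in>fam M. a F * basis_mark G F K)"
    using assms by (auto simp: mark_span_def)
  have "basis_mark G F (K \<union> H) = (if H \<subseteq> M then basis_mark G F K else 0)" if "F \<in> fam M" for F K
  proof -
    have "F \<in> \<D>" using that fam_subset by blast
    thus ?thesis
      using basis_mark_Un_normal[OF subgroup_D normal_S[OF assms(1)], of F K]
        fam_core[OF that assms(2,1)] by simp
  qed
  hence "fixed_part H f = (\<lambda>K. \<Sum>F\<in>fam M. a F * (if H \<subseteq> M then basis_mark G F K else 0))"
    unfolding f fixed_part_def by (intro ext sum.cong) auto
  thus ?thesis by (auto simp: f)
qed

lemma mark_span_decompose:
  assumes "f \<in> mark_span G \<D>"
  obtains c where "\<And>M. M \<in> S \<Longrightarrow> c M \<in> mark_span G (fam M)" "f = (\<Sum>M\<in>S. c M)"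
proof -
  obtain a where f: "f = (\<lambda>K. \<Sum>F\<in>\<D>. a F * basis_mark G F K)"
    using assms by (auto simp: mark_span_def)
  let ?c = "\<lambda>M K. \<Sum>F\<in>fam M. a F * basis_mark G F K"
  have sum: "f = (\<Sum>M\<in>S. ?c M)"
  proof
    fix K
    have "f K = (\<Sum>F\<in>(\<Union>M\<in>S. fam M). a F * basis_mark G F K)" using f D_eq_UN_fam by simp
    also have "\<dots> = (\<Sum>M\<in>S. ?c M K)"
      using finite_S finite_subset[OF fam_subset finite_D] fam_disjoint
      by (intro sum.UNION_disjoint) auto
    finally show "f K = (\<Sum>M\<in>S. ?c M) K" by (simp only: sum_fun_apply)
  qed
  have "?c M \<in> mark_span G (fam M)" for M by (auto simp: mark_span_def)
  thus ?thesis using sum by (rule that[of ?c])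
qed

text \<open>
  Induction from large to small members of \<open>S\<close>, the direction in which graded components and
  factors of units can be read off.
\<close>

lemma S_down_induct [consumes 1, case_names step]:
  assumes "H \<in> S"
    and "\<And>H. H \<in> S \<Longrightarrow> (\<And>L. L \<in> S \<Longrightarrow> H \<subset> L \<Longrightarrow> P L) \<Longrightarrow> P H"
  shows "P H"
  using assms(1)
proof (induction "card (carrier G) - card H" arbitrary: H rule: less_induct)
  case less
  show ?case
  proof (rule assms(2)[OF less.prems])
    fix L assume L: "L \<in> S" "H \<subset> L"
    have "card L \<le> card (carrier G)" "card H < card L"
      using subset_S[OF L(1)] finite_carrier L(2)
      by (auto intro: card_mono psubset_card_mono finite_subset)
    thus "P L" using L by (intro less.hyps) auto
  qed
qed

text \<open>
  The image of \<open>f = \<Sum>\<^sub>M c\<^sub>M\<close> under the endomorphism at \<open>L\<close> is \<open>\<Sum>\<^bsub>M \<ge> L\<^esub> c\<^sub>M\<close>. If these sums vanish for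
  all \<open>L > H\<close>, then so do the components \<open>c\<^sub>L\<close>, one after the other from the top, and the image at \<open>H\<close>,
  which is \<open>f\<close>, reduces to \<open>c\<^sub>H\<close>.
\<close>

lemma mark_span_fam_if_fixed_part:
  assumes "H \<in> S" "f \<in> mark_span G \<D>" "fixed_part H f = f"
    and "\<And>L. L \<in> S \<Longrightarrow> H \<subset> L \<Longrightarrow> fixed_part L f = 0"
  shows "f \<in> mark_span G (fam H)"
proof -
  obtain c where c: "\<And>M. M \<in> S \<Longrightarrow> c M \<in> mark_span G (fam M)" and f: "f = (\<Sum>M\<in>S. c M)"
    using mark_span_decompose[OF assms(2)] by metis
  have r: "fixed_part L f = c L + (\<Sum>M\<in>{M\<in>S. L \<subset> M}. c M)" if L: "L \<in> S" for L
  proof -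
    have "fixed_part L f = (\<Sum>M\<in>S. if L \<subseteq> M then c M else 0)"
      unfolding f fixed_part_sum by (intro sum.cong refl fixed_part_fam[OF L _ c])
    also have "\<dots> = (\<Sum>M\<in>{M\<in>S. L \<subseteq> M}. c M)"
      using finite_S by (simp add: sum.inter_filter)
    also have "{M\<in>S. L \<subseteq> M} = insert L {M\<in>S. L \<subset> M}" using L by auto
    also have "(\<Sum>M\<in>\<dots>. c M) = c L + (\<Sum>M\<in>{M\<in>S. L \<subset> M}. c M)"
      using finite_S by (intro sum.insert) auto
    finally show ?thesis .
  qed
  have "H \<subset> L \<longrightarrow> c L = 0" if "L \<in> S" for L
    using that
  proof (induction rule: S_down_induct)
    case (step L)
    show ?case
    proof
      assume "H \<subset> L"
      have "(\<Sum>M\<in>{M\<in>S. L \<subset> M}. c M) = 0"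
      proof (intro sum.neutral ballI)
        fix M assume "M \<in> {M\<in>S. L \<subset> M}"
        hence M: "M \<in> S" "L \<subset> M" by auto
        have "H \<subset> M" using \<open>H \<subset> L\<close> M(2) by (rule psubset_trans)
        thus "c M = 0" using step.IH[OF M] by (rule rev_mp)
      qed
      thus "c L = 0" using r[OF step.hyps] assms(4)[OF step.hyps \<open>H \<subset> L\<close>] by simp
    qed
  qed
  hence "(\<Sum>M\<in>{M\<in>S. H \<subset> M}. c M) = 0" by (intro sum.neutral) simp
  hence "f = c H" using r[OF assms(1)] assms(3) by simp
  thus ?thesis using c[OF assms(1)] by simp
qed

lemma mark_bar_span_D:
  assumes "x \<in> mark_bar G (fam H)"
  shows "1 + x \<in> mark_span G \<D>"
proof -
  have "x \<in> mark_span G \<D>"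
    using assms mark_span_mono[OF finite_D fam_subset] by (auto simp: mark_bar_def)
  thus ?thesis using one_in_mark_span[OF finite_D carrier_D] mark_span_add by blast
qed

lemma mark_span_prod:
  assumes "\<And>i. i \<in> I \<Longrightarrow> f i \<in> mark_span G \<D>"
  shows "(\<Prod>i\<in>I. f i) \<in> mark_span G \<D>"
  using assms
proof (induction I rule: infinite_finite_induct)
  case (insert i I)
  show ?case unfolding prod.insert[OF insert.hyps]
    by (intro mark_span_mult[OF closed_D] insert.IH insert.prems) auto
next
  case (infinite I)
  show ?case unfolding prod.infinite[OF infinite.hyps] by (rule one_in_mark_span[OF finite_D carrier_D])
next
  case empty
  show ?case using one_in_mark_span[OF finite_D carrier_D] by (simp only: prod.empty)
qed

lemma square_prod_one_plus:
  assumes "\<And>H. H \<in> T \<Longrightarrow> x H \<in> mark_bar G (fam H)"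
  shows "(\<Prod>H\<in>T. 1 + x H) * (\<Prod>H\<in>T. 1 + x H) = 1"
proof -
  have "(\<Prod>H\<in>T. 1 + x H) * (\<Prod>H\<in>T. 1 + x H) = (\<Prod>H\<in>T. (1 + x H) * (1 + x H))"
    by (rule prod.distrib[symmetric])
  also have "\<dots> = 1" using mark_bar_square[OF assms] by (intro prod.neutral ballI)
  finally show ?thesis .
qed

text \<open>
  The factors of index not above \<open>L\<close> become 1, so a product of factors shows its factors from the top
  of \<open>S\<close> downwards.
\<close>

lemma fixed_part_prod_one_plus:
  assumes "L \<in> S" "T \<subseteq> S" "\<And>H. H \<in> T \<Longrightarrow> x H \<in> mark_bar G (fam H)"
  shows "fixed_part L (\<Prod>H\<in>T. 1 + x H) = (\<Prod>H\<in>{H\<in>T. L \<subseteq> H}. 1 + x H)"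
proof -
  have T: "finite T" using assms(2) finite_S finite_subset by blast
  have r: "fixed_part L (1 + x H) = (if L \<subseteq> H then 1 + x H else 1)" if H: "H \<in> T" for H
  proof -
    have "fixed_part L (x H) = (if L \<subseteq> H then x H else 0)"
      using assms H by (intro fixed_part_fam) (auto simp: mark_bar_def)
    thus ?thesis by simp
  qed
  have "fixed_part L (\<Prod>H\<in>T. 1 + x H) = (\<Prod>H\<in>T. if L \<subseteq> H then 1 + x H else 1)"
    unfolding fixed_part_prod by (intro prod.cong refl r)
  also have "\<dots> = (\<Prod>H\<in>{H\<in>T. L \<subseteq> H}. 1 + x H)" using T by (simp only: prod.inter_filter)
  finally show ?thesis .
qed

lemma prod_one_plus_in_units:
  assumes "\<And>H. H \<in> T \<Longrightarrow> x H \<in> mark_bar G (fam H)"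
  shows "(\<Prod>H\<in>T. 1 + x H) \<in> mark_units G \<D>"
  unfolding mark_units_def
  by (intro CollectI conjI square_prod_one_plus mark_span_prod)
    (rule mark_bar_span_D, erule assms, erule assms)

text \<open>
  The endomorphism at \<open>L\<close> leaves the factors of index \<open>\<ge> L\<close>. Those of index \<open>> L\<close> agree by induction and
  their product has square 1, so it can be cancelled.
\<close>

lemma inj_prod_one_plus:
  "inj_on (\<lambda>x. \<Prod>H\<in>S. 1 + x H) (\<Pi>\<^sub>E H\<in>S. mark_bar G (fam H))"
proof (rule inj_onI)
  fix x y assume x: "x \<in> (\<Pi>\<^sub>E H\<in>S. mark_bar G (fam H))" and y: "y \<in> (\<Pi>\<^sub>E H\<in>S. mark_bar G (fam H))"
    and eq: "(\<Prod>H\<in>S. 1 + x H) = (\<Prod>H\<in>S. 1 + y H)"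
  have mem: "x H \<in> mark_bar G (fam H)" "y H \<in> mark_bar G (fam H)" if "H \<in> S" for H
    using x y that by auto
  have "x L = y L" if "L \<in> S" for L
    using that
  proof (induction rule: S_down_induct)
    case (step L)
    let ?T = "{H\<in>S. L \<subset> H}"
    let ?P = "\<Prod>H\<in>?T. 1 + x H"
    have L: "{H\<in>S. L \<subseteq> H} = insert L ?T" "finite ?T" "L \<notin> ?T" using step.hyps finite_S by auto
    have "(\<Prod>H\<in>?T. 1 + y H) = ?P" 
    proof (intro prod.cong refl)
      fix M assume "M \<in> ?T"
      thus "1 + y M = 1 + x M" using step.IH[of M] by simp
    qed
    moreover have "(\<Prod>H\<in>{H\<in>S. L \<subseteq> H}. 1 + x H) = (\<Prod>H\<in>{H\<in>S. L \<subseteq> H}. 1 + y H)"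
      using fixed_part_prod_one_plus[OF step.hyps order_refl mem(1)]
        fixed_part_prod_one_plus[OF step.hyps order_refl mem(2)] eq by metis
    ultimately have "(1 + x L) * ?P = (1 + y L) * ?P"
      unfolding L(1) prod.insert[OF L(2,3)] by simp
    hence "(1 + x L) * (?P * ?P) = (1 + y L) * (?P * ?P)" 
      unfolding mult.assoc[symmetric] by (rule arg_cong[where f = "\<lambda>z. z * ?P"])
    moreover have "?P * ?P = 1" using mem(1) by (intro square_prod_one_plus) auto
    ultimately show ?case by simp
  qed
  thus "x = y" by (rule PiE_ext[OF x y])
qed

text \<open>
  The factors of \<open>u\<close> are constructed for growing upward closed sets \<open>T\<close>, so that the statement at \<open>T\<close>
  involves only indices that have been treated. For \<open>T = S\<close> its instance at \<open>L = 1\<close> is the desired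
  factorisation.
\<close>

lemma units_factor_upset:
  assumes u: "u \<in> mark_units G \<D>"
    and "T \<subseteq> S" "\<And>H L. H \<in> T \<Longrightarrow> L \<in> S \<Longrightarrow> H \<subseteq> L \<Longrightarrow> L \<in> T"
  shows "\<exists>x. (\<forall>H\<in>T. x H \<in> mark_bar G (fam H)) \<and>
    (\<forall>L\<in>T. fixed_part L u = (\<Prod>H\<in>{H\<in>T. L \<subseteq> H}. 1 + x H))"
  using assms(2-)
proof (induction "card T" arbitrary: T)
  case 0
  hence "T = {}" using finite_subset[OF _ finite_S, of T] by simp
  thus ?case by simp
next
  case (Suc n)
  have T: "finite T" by (rule finite_subset[OF Suc.prems(1) finite_S])
  have "T \<noteq> {}" using Suc.hyps(2) by auto
  then obtain H where H: "H \<in> T" and min: "\<And>K. K \<in> T \<Longrightarrow> K \<subseteq> H \<Longrightarrow> K = H"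
    using finite_has_minimal[OF T] by metis
  have HS: "H \<in> S" using H Suc.prems by auto
  let ?T = "T - {H}"
  have n: "n = card ?T" using Suc.hyps(2) H T by simp
  have up: "L \<in> ?T" if "K \<in> ?T" "L \<in> S" "K \<subseteq> L" for K L
    using Suc.prems(2)[of K L] min that by auto
  have "?T \<subseteq> S" using Suc.prems(1) by auto
  hence "\<exists>x. (\<forall>K\<in>?T. x K \<in> mark_bar G (fam K)) \<and>
    (\<forall>L\<in>?T. fixed_part L u = (\<Prod>K\<in>{K\<in>?T. L \<subseteq> K}. 1 + x K))"
    by (rule Suc.hyps(1)[OF n]) (rule up)
  then obtain x where "\<forall>K\<in>?T. x K \<in> mark_bar G (fam K)"
    and "\<forall>L\<in>?T. fixed_part L u = (\<Prod>K\<in>{K\<in>?T. L \<subseteq> K}. 1 + x K)"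
    by (elim exE conjE) (rule that)
  note x = this(1)[rule_format] and eq = this(2)[rule_format]
  let ?U = "{K\<in>?T. H \<subseteq> K}"
  let ?P = "\<Prod>K\<in>?U. 1 + x K"
  \<comment> \<open>The factor at \<open>H\<close>; the product \<open>?P\<close> of the factors above \<open>H\<close> is its own inverse.\<close>
  define v where "v = fixed_part H u * ?P"
  have U: "?U \<subseteq> S" "\<And>K. K \<in> ?U \<Longrightarrow> x K \<in> mark_bar G (fam K)" using Suc.prems(1) x by auto
  have uu: "fixed_part L u * fixed_part L u = 1" for L
  proof -
    have "u * u = 1" using u unfolding mark_units_def by blast
    hence "fixed_part L (u * u) = 1" by (simp only: fixed_part_one)
    thus ?thesis by (simp only: fixed_part_mult)
  qed
  have PP: "?P * ?P = 1" by (rule square_prod_one_plus[OF U(2)])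
  have "v * v = (fixed_part H u * fixed_part H u) * (?P * ?P)" unfolding v_def by (simp only: mult_ac)
  hence vv: "v * v = 1" using uu PP by simp
  have "v \<in> mark_span G \<D>"
    unfolding v_def using u U(2)
    by (intro mark_span_mult[OF closed_D] fixed_part_span[OF HS] mark_span_prod mark_bar_span_D)
      (auto simp: mark_units_def)
  hence v1: "v - 1 \<in> mark_span G \<D>"
    using one_in_mark_span[OF finite_D carrier_D] mark_span_diff by blast
  \<comment> \<open>At every \<open>L > H\<close> the functions \<open>u\<close> and \<open>?P\<close> have the same image, of square 1.\<close>
  have rP: "fixed_part L ?P = (\<Prod>K\<in>{K\<in>?U. L \<subseteq> K}. 1 + x K)" if "L \<in> S" for L
    by (rule fixed_part_prod_one_plus[OF that U])
  have "{K\<in>?U. H \<subseteq> K} = ?U" by auto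
  hence "fixed_part H v = v" unfolding v_def using rP[OF HS] by (simp add: fixed_part_fixed_part)
  moreover have "fixed_part L v = 1" if L: "L \<in> S" "H \<subset> L" for L
  proof -
    have LT: "L \<in> ?T" using L H Suc.prems(2) by auto
    have "{K\<in>?U. L \<subseteq> K} = {K\<in>?T. L \<subseteq> K}" using L by auto
    hence "fixed_part L ?P = fixed_part L u" using rP[OF L(1)] eq[OF LT] by simp
    moreover have "fixed_part L (fixed_part H u) = fixed_part L u" using L by (intro fixed_part_fixed_part) auto
    ultimately show ?thesis unfolding v_def using uu by simp
  qed
  ultimately have "v - 1 \<in> mark_span G (fam H)"
    using v1 by (intro mark_span_fam_if_fixed_part[OF HS]) auto
  moreover have "(v - 1) * (v - 1) + ((v - 1) + (v - 1)) = 0"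
    unfolding bar_square_one using vv by simp
  ultimately have vbar: "v - 1 \<in> mark_bar G (fam H)" unfolding mark_bar_def by blast
  have "v * ?P = fixed_part H u * (?P * ?P)" unfolding v_def by (simp only: mult_ac)
  hence vP: "fixed_part H u = v * ?P" unfolding PP mult_1_right by (rule sym)
  let ?x = "x(H := v - 1)"
  have "fixed_part L u = (\<Prod>K\<in>{K\<in>T. L \<subseteq> K}. 1 + ?x K)" if L: "L \<in> T" for L
  proof (cases "L = H")
    case True
    have "{K\<in>T. L \<subseteq> K} = insert H ?U" using True H by auto
    hence "(\<Prod>K\<in>{K\<in>T. L \<subseteq> K}. 1 + ?x K) = (\<Prod>K\<in>insert H ?U. 1 + ?x K)" by (rule arg_cong)
    also have "\<dots> = (1 + ?x H) * (\<Prod>K\<in>?U. 1 + ?x K)"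
      using T by (intro prod.insert) auto
    also have "(\<Prod>K\<in>?U. 1 + ?x K) = ?P" by (intro prod.cong refl) auto
    also have "1 + ?x H = v" by simp
    finally have P: "(\<Prod>K\<in>{K\<in>T. L \<subseteq> K}. 1 + ?x K) = v * ?P" .
    show ?thesis unfolding P unfolding True by (rule vP)
  next
    case False
    hence "\<not> L \<subseteq> H" using min[OF L] by auto
    hence T': "{K\<in>T. L \<subseteq> K} = {K\<in>?T. L \<subseteq> K}" by auto
    have P: "(\<Prod>K\<in>{K\<in>?T. L \<subseteq> K}. 1 + ?x K) = (\<Prod>K\<in>{K\<in>?T. L \<subseteq> K}. 1 + x K)"
      by (intro prod.cong refl) simp
    show ?thesis unfolding T' P by (rule eq) (use L False in simp)
  qed
  moreover have "?x K \<in> mark_bar G (fam K)" if "K \<in> T" for K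
    using that x[of K] vbar by (cases "K = H") simp_all
  ultimately show ?case by blast
qed

lemma units_factor:
  assumes "u \<in> mark_units G \<D>"
  obtains x where "x \<in> (\<Pi>\<^sub>E H\<in>S. mark_bar G (fam H))" "u = (\<Prod>H\<in>S. 1 + x H)"
proof -
  obtain x where x: "\<And>H. H \<in> S \<Longrightarrow> x H \<in> mark_bar G (fam H)"
    and eq: "\<And>L. L \<in> S \<Longrightarrow> fixed_part L u = (\<Prod>H\<in>{H\<in>S. L \<subseteq> H}. 1 + x H)"
    using units_factor_upset[OF assms, of S] by blast
  have one: "{\<one>} \<in> S" using basic by (simp add: basic_collection_def)
  have "u (K \<union> {\<one>}) = u K" for K
  proof -
    have "basis_mark G F (K \<union> {\<one>}) = basis_mark G F K" if "F \<in> \<D>" for F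
      using basis_mark_Un_normal[OF subgroup_D[OF that] normal_S[OF one], of K]
        subgroup.one_closed[OF subgroup_D[OF that]] by simp
    thus ?thesis using assms by (auto simp: mark_units_def mark_span_def)
  qed
  hence "u = fixed_part {\<one>} u" by (simp add: fixed_part_def)
  also have "{H\<in>S. {\<one>} \<subseteq> H} = S"
    using normal_S normal_imp_subgroup subgroup.one_closed by fastforce
  hence "fixed_part {\<one>} u = (\<Prod>H\<in>S. 1 + x H)" using eq[OF one] by simp
  also have "\<dots> = (\<Prod>H\<in>S. 1 + restrict x S H)" by (intro prod.cong) auto
  finally show ?thesis using x by (intro that[of "restrict x S"]) auto
qed

lemma bij_prod_one_plus:
  "bij_betw (\<lambda>x. \<Prod>H\<in>S. 1 + x H) (\<Pi>\<^sub>E H\<in>S. mark_bar G (fam H)) (mark_units G \<D>)"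
  unfolding bij_betw_def
proof (intro conjI inj_prod_one_plus equalityI subsetI)
  fix u assume "u \<in> (\<lambda>x. \<Prod>H\<in>S. 1 + x H) ` (\<Pi>\<^sub>E H\<in>S. mark_bar G (fam H))"
  then obtain x where "x \<in> (\<Pi>\<^sub>E H\<in>S. mark_bar G (fam H))" "u = (\<Prod>H\<in>S. 1 + x H)" by blast
  thus "u \<in> mark_units G \<D>" using prod_one_plus_in_units[of S x] by (auto simp: PiE_mem)
next
  fix u assume "u \<in> mark_units G \<D>"
  thus "u \<in> (\<lambda>x. \<Prod>H\<in>S. 1 + x H) ` (\<Pi>\<^sub>E H\<in>S. mark_bar G (fam H))"
    using units_factor by blast
qed

text \<open>
  The family of index \<open>G\<close> consists of \<open>G\<close> alone, whose basis mark is 1; the combinations are the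
  constants, and 0 and -2 are the constant solutions. This accounts for the factor 2.
\<close>

lemma mark_bar_carrier: "mark_bar G (fam (carrier G)) = {0, - 1 - 1}"
proof -
  have fam: "fam (carrier G) = {carrier G}"
    using carrier_D subgroup.subset[OF subgroup_D] subset_S by (auto simp: S_family_def)
  have "f \<in> {0, - 1 - 1}" if f: "f \<in> mark_bar G {carrier G}" for f
  proof -
    obtain a where "f = (\<lambda>K. a)"
      using f by (auto simp: mark_bar_def mark_span_def basis_mark_carrier)
    moreover from this have "a = 0 \<or> a = - 2" using f by (auto simp: mark_bar_iff)
    ultimately show ?thesis by (auto simp: fun_eq_iff)
  qed
  moreover have "0 \<in> mark_bar G {carrier G}"
    by (simp add: mark_bar_def mark_span_zero)
  moreover have "- 1 - 1 \<in> mark_bar G {carrier G}"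
  proof -
    have "- 1 - 1 \<in> mark_span G {carrier G}"
      by (intro mark_span_diff mark_span_uminus one_in_mark_span) simp_all
    thus ?thesis unfolding mark_bar_iff by (rule conjI) simp
  qed
  ultimately show ?thesis unfolding fam by blast
qed

lemma carrier_S: "carrier G \<in> S"
  using basic by (simp add: basic_collection_def collection_def)

theorem card_mark_units:
  "finite (mark_units G \<D>)"
  "card (mark_units G \<D>) = 2 * (\<Prod>H \<in> S - {carrier G}. card (mark_bar G (fam H)))"
proof -
  have "finite (\<Pi>\<^sub>E H\<in>S. mark_bar G (fam H))"
    by (intro finite_PiE finite_S finite_mark_bar)
  thus "finite (mark_units G \<D>)" using bij_prod_one_plus bij_betw_finite by blast
  have "card (mark_units G \<D>) = (\<Prod>H\<in>S. card (mark_bar G (fam H)))"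
    using bij_betw_same_card[OF bij_prod_one_plus] card_PiE[OF finite_S] by metis
  also have "\<dots> = card (mark_bar G (fam (carrier G))) * (\<Prod>H \<in> S - {carrier G}. card (mark_bar G (fam H)))"
    by (rule prod.remove[OF finite_S carrier_S])
  also have "card (mark_bar G (fam (carrier G))) = 2"
    unfolding mark_bar_carrier by (auto simp: fun_eq_iff card_insert_if)
  finally show "card (mark_units G \<D>) = 2 * (\<Prod>H \<in> S - {carrier G}. card (mark_bar G (fam H)))" .
qed

end

section \<open>Isomorphism classes of finite actions are determined by their marks\<close>

lemma group_action_sum:
  assumes "group_action G X \<phi>" "group_action G Y \<psi>"
  shows "group_action G (X <+> Y) (sum_action X \<phi> Y \<psi>)"
proof (rule group_actionI)
  show "group G" by (rule action_group[OF assms(1)])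
qed (auto simp: sum_action_def group_action_one[OF assms(1)] group_action_one[OF assms(2)]
    group_action_closed[OF assms(1)] group_action_closed[OF assms(2)]
    group_action.composition_rule[OF assms(1)] group_action.composition_rule[OF assms(2)])

lemma mark_sum_action:
  assumes "finite X" "finite Y"
  shows "mark G (X <+> Y) (sum_action X \<phi> Y \<psi>) = mark G X \<phi> + mark G Y \<psi>"
proof
  fix K
  have "fixed_points G (X <+> Y) (sum_action X \<phi> Y \<psi>) K
      = fixed_points G X \<phi> K <+> fixed_points G Y \<psi> K"
    by (auto simp: fixed_points_def sum_action_def)
  moreover have "finite (fixed_points G X \<phi> K)" "finite (fixed_points G Y \<psi> K)"
    using assms by (auto simp: fixed_points_def)
  ultimately show "mark G (X <+> Y) (sum_action X \<phi> Y \<psi>) K = (mark G X \<phi> + mark G Y \<psi>) K"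
    by (simp add: mark_def card_Plus)
qed

text \<open>
  The classes in the Burnside ring are formed from actions on sets of natural numbers; sums, products
  and coset spaces have to be transported there.
\<close>

lemma nat_model:
  assumes "group_action G X \<phi>" "finite X"
  obtains Y :: "nat set" and \<psi> where "finite Y" "group_action G Y \<psi>" "mark G Y \<psi> = mark G X \<phi>"
proof -
  obtain f where f: "bij_betw f X {0..<card X}" using ex_bij_betw_finite_nat[OF assms(2)] by blast
  let ?Y = "{0..<card X}"
  let ?f' = "inv_into X f"
  \<comment> \<open>The action is carried along \<open>f\<close>; outside \<open>?Y\<close> it is undefined, as actions are required to be extensional.\<close>
  define \<psi> where "\<psi> g = (\<lambda>y\<in>?Y. f (\<phi> g (?f' y)))" for g
  have f': "?f' y \<in> X" "f (?f' y) = y" if "y \<in> ?Y" for y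
    using f that by (auto simp: bij_betw_def inv_into_into f_inv_into_f)
  have f1: "f x \<in> ?Y" "?f' (f x) = x" if "x \<in> X" for x
    using f that by (auto simp: bij_betw_def)
  have "group_action G ?Y \<psi>"
  proof (rule group_actionI)
    show "group G" by (rule action_group[OF assms(1)])
    show "\<psi> g \<in> extensional ?Y" for g by (simp add: \<psi>_def)
    show "\<psi> g y \<in> ?Y" if "g \<in> carrier G" "y \<in> ?Y" for g y
      unfolding \<psi>_def restrict_apply'[OF that(2)]
      by (intro f1 group_action_closed[OF assms(1)] f' that)
    show "\<psi> \<one>\<^bsub>G\<^esub> y = y" if "y \<in> ?Y" for y
      using that f' group_action_one[OF assms(1)] by (simp add: \<psi>_def del: atLeastLessThan_iff)
    show "\<psi> (g \<otimes>\<^bsub>G\<^esub> h) y = \<psi> g (\<psi> h y)" if "g \<in> carrier G" "h \<in> carrier G" "y \<in> ?Y" for g h y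
      using that f' f1 group_action_closed[OF assms(1)] group_action.composition_rule[OF assms(1)]
      by (simp add: \<psi>_def del: atLeastLessThan_iff)
  qed
  moreover have "gset_iso G X \<phi> ?Y \<psi>"
    unfolding gset_iso_def using f f1 by (intro exI[of _ f]) (auto simp: \<psi>_def simp del: atLeastLessThan_iff)
  hence "mark G ?Y \<psi> = mark G X \<phi>" using mark_gset_iso[OF stable_action[OF assms(1)]] by metis
  ultimately show ?thesis using that by blast
qed

definition mark_class :: "('g, 'm) monoid_scheme \<Rightarrow> ('g set \<Rightarrow> int) \<Rightarrow> 'g gset_cls" where
  "mark_class G m = {(Y, \<psi>). finite Y \<and> group_action G Y \<psi> \<and> mark G Y \<psi> = m}"

definition gset_marks :: "('g, 'm) monoid_scheme \<Rightarrow> ('g set \<Rightarrow> int) set" where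
  "gset_marks G = {mark G X \<phi> | (X :: nat set) \<phi>. finite X \<and> group_action G X \<phi>}"

lemma mark_in_gset_marks:
  assumes "group_action G X \<phi>" "finite X"
  shows "mark G X \<phi> \<in> gset_marks G"
proof -
  obtain Y :: "nat set" and \<psi> where "finite Y" "group_action G Y \<psi>" "mark G Y \<psi> = mark G X \<phi>"
    using nat_model[OF assms] .
  thus ?thesis unfolding gset_marks_def by (metis (mono_tags, lifting) mem_Collect_eq)
qed

lemma mark_class_nonempty: "m \<in> gset_marks G \<Longrightarrow> mark_class G m \<noteq> {}"
  by (auto simp: gset_marks_def mark_class_def)

lemma inj_mark_class: "inj_on (mark_class G) (gset_marks G)"
proof (rule inj_onI)
  fix m n assume "m \<in> gset_marks G" and eq: "mark_class G m = mark_class G n"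
  then obtain Y \<psi> where "(Y, \<psi>) \<in> mark_class G m" using mark_class_nonempty by fast
  moreover from this have "(Y, \<psi>) \<in> mark_class G n" using eq by simp
  ultimately show "m = n" by (simp add: mark_class_def)
qed

text \<open>
  Burnside's theorem identifies isomorphism classes with mark functions, so that no isomorphism has
  to be exhibited for the semiring operations.
\<close>

lemma (in finite_group) gset_class_eq:
  assumes "group_action G X \<phi>" "finite X"
  shows "gset_class G X \<phi> = mark_class G (mark G X \<phi>)"
proof -
  have "gset_iso G X \<phi> Y \<psi> \<longleftrightarrow> mark G Y \<psi> = mark G X \<phi>"
    if "finite Y" "group_action G Y \<psi>" for Y :: "nat set" and \<psi>
    using mark_gset_iso[OF stable_action[OF assms(1)], of Y \<psi>]
      gset_iso_if_mark_eq[OF assms(1) that(2) order_refl stable_action[OF assms(1)] assms(2)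
        order_refl stable_action[OF that(2)] that(1)] by auto
  thus ?thesis unfolding gset_class_def mark_class_def by blast
qed

section \<open>Semirings embedded in a commutative ring\<close>

text \<open>
  A semiring that is embedded, by the inverse of \<open>c\<close>, in a commutative ring is cancellative, and its
  Grothendieck ring is the set of differences of elements of \<open>M\<close>: the class of \<open>(c m, c n)\<close>
  corresponds to \<open>m - n\<close>.
\<close>

locale semiring_in_ring =
  fixes R (structure) and c :: "'b :: comm_ring_1 \<Rightarrow> 'a" and M :: "'b set"
  assumes carrier: "carrier R = c ` M"
    and inj: "inj_on c M"
    and M_zero: "0 \<in> M" and M_one: "1 \<in> M"
    and M_add: "m \<in> M \<Longrightarrow> n \<in> M \<Longrightarrow> m + n \<in> M"
    and M_mult: "m \<in> M \<Longrightarrow> n \<in> M \<Longrightarrow> m * n \<in> M"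
    and zero: "\<zero> = c 0" and one: "\<one> = c 1"
    and add: "m \<in> M \<Longrightarrow> n \<in> M \<Longrightarrow> c m \<oplus> c n = c (m + n)"
    and mult: "m \<in> M \<Longrightarrow> n \<in> M \<Longrightarrow> c m \<otimes> c n = c (m * n)"
begin

definition diffs :: "'b set" where
  "diffs = {m - n | m n. m \<in> M \<and> n \<in> M}"

definition diff_class :: "'b \<Rightarrow> ('a \<times> 'a) set" where
  "diff_class z = {(c m, c n) | m n. m \<in> M \<and> n \<in> M \<and> m - n = z}"

lemma diffsI: "m \<in> M \<Longrightarrow> n \<in> M \<Longrightarrow> m - n \<in> diffs"
  by (auto simp: diffs_def)

lemma M_subset_diffs: "M \<subseteq> diffs"
  using diffsI[OF _ M_zero] by auto

lemma diffs_add: "z \<in> diffs \<Longrightarrow> w \<in> diffs \<Longrightarrow> z + w \<in> diffs"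
proof -
  assume "z \<in> diffs" "w \<in> diffs"
  then obtain m n p q where "m \<in> M" "n \<in> M" "p \<in> M" "q \<in> M" "z = m - n" "w = p - q"
    by (auto simp: diffs_def)
  moreover from this have "z + w = (m + p) - (n + q)" by simp
  ultimately show ?thesis using M_add diffsI by metis
qed

lemma diffs_mult: "z \<in> diffs \<Longrightarrow> w \<in> diffs \<Longrightarrow> z * w \<in> diffs"
proof -
  assume "z \<in> diffs" "w \<in> diffs"
  then obtain m n p q where M: "m \<in> M" "n \<in> M" "p \<in> M" "q \<in> M" and zw: "z = m - n" "w = p - q"
    by (auto simp: diffs_def)
  have "z * w = (m * p + n * q) - (m * q + n * p)"
    unfolding zw by (simp add: algebra_simps)
  thus ?thesis using diffsI[OF M_add[OF M_mult M_mult] M_add[OF M_mult M_mult]] M by metis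
qed

lemma diffs_uminus: "z \<in> diffs \<Longrightarrow> - z \<in> diffs"
proof -
  assume "z \<in> diffs"
  then obtain m n where M: "m \<in> M" "n \<in> M" and z: "z = m - n" by (auto simp: diffs_def)
  show ?thesis unfolding z minus_diff_eq using diffsI[OF M(2,1)] .
qed

lemma groth_rel_class:
  assumes "m \<in> M" "n \<in> M"
  shows "groth_rel R `` {(c m, c n)} = diff_class (m - n)"
proof -
  have eq: "c m' = c n' \<longleftrightarrow> m' = n'" if "m' \<in> M" "n' \<in> M" for m' n'
    using inj that by (auto dest: inj_onD)
  have "((c m, c n), (c p, c q)) \<in> groth_rel R \<longleftrightarrow> p - q = m - n" if "p \<in> M" "q \<in> M" for p q
  proof -
    have "((c m, c n), (c p, c q)) \<in> groth_rel R \<longleftrightarrow>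
        (\<exists>e\<in>M. c (m + q + e) = c (p + n + e))"
      using assms that by (simp add: groth_rel_def carrier add M_add)
    also have "\<dots> \<longleftrightarrow> m + q = p + n"
      using assms that M_zero by (auto simp: eq M_add)
    also have "\<dots> \<longleftrightarrow> p - q = m - n" by (simp add: algebra_simps eq_commute)
    finally show ?thesis .
  qed
  moreover have "groth_rel R `` {(c m, c n)} \<subseteq> c ` M \<times> c ` M"
    by (auto simp: groth_rel_def carrier)
  ultimately show ?thesis unfolding diff_class_def by blast
qed

lemma diff_class_nonempty: "z \<in> diffs \<Longrightarrow> diff_class z \<noteq> {}"
  by (auto simp: diffs_def diff_class_def)

lemma inj_diff_class: "inj_on diff_class diffs"
proof (rule inj_onI)
  fix z w assume z: "z \<in> diffs" and eq: "diff_class z = diff_class w"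
  obtain m n where mn: "m \<in> M" "n \<in> M" "z = m - n" using z by (auto simp: diffs_def)
  hence "(c m, c n) \<in> diff_class z" by (auto simp: diff_class_def)
  hence "(c m, c n) \<in> diff_class w" using eq by simp
  then obtain m' n' where "m' \<in> M" "n' \<in> M" "c m = c m'" "c n = c n'" "w = m' - n'"
    by (auto simp: diff_class_def)
  thus "z = w" using mn inj by (metis inj_onD)
qed

lemma groth_carrier: "carrier (groth_ring R) = diff_class ` diffs"
proof -
  have "carrier (groth_ring R) = (\<lambda>(m, n). diff_class (m - n)) ` (M \<times> M)"
    unfolding groth_ring_def quotient_def carrier
    by (force simp: groth_rel_class)
  also have "\<dots> = diff_class ` diffs" by (force simp: diffs_def)
  finally show ?thesis .
qed

lemma groth_zero: "\<zero>\<^bsub>groth_ring R\<^esub> = diff_class 0"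
  using groth_rel_class[OF M_zero M_zero] by (simp add: groth_ring_def zero)

lemma groth_one: "\<one>\<^bsub>groth_ring R\<^esub> = diff_class 1"
  using groth_rel_class[OF M_one M_zero] by (simp add: groth_ring_def zero one)

lemma groth_of_class: "m \<in> M \<Longrightarrow> groth_of R (c m) = diff_class m"
  using groth_rel_class[OF _ M_zero] by (simp add: groth_of_def zero)

lemma UN_diff_class:
  assumes "z \<in> diffs" "w \<in> diffs"
    and "\<And>m n p q. m \<in> M \<Longrightarrow> n \<in> M \<Longrightarrow> p \<in> M \<Longrightarrow> q \<in> M \<Longrightarrow>
      m - n = z \<Longrightarrow> p - q = w \<Longrightarrow> f (c m) (c n) (c p) (c q) = C"
  shows "(\<Union>(a, b) \<in> diff_class z. \<Union>(a', b') \<in> diff_class w. f a b a' b') = C"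
proof (rule SUP_eq_const[OF diff_class_nonempty[OF assms(1)]])
  fix ab assume "ab \<in> diff_class z"
  then obtain m n where "m \<in> M" "n \<in> M" "m - n = z" "ab = (c m, c n)"
    by (auto simp: diff_class_def)
  hence "(\<Union>(a', b') \<in> diff_class w. f (c m) (c n) a' b') = C"
    by (intro SUP_eq_const[OF diff_class_nonempty[OF assms(2)]])
      (auto simp: diff_class_def assms(3))
  thus "(case ab of (a, b) \<Rightarrow> \<Union>(a', b') \<in> diff_class w. f a b a' b') = C"
    using \<open>ab = (c m, c n)\<close> by simp
qed

lemma groth_add:
  assumes "z \<in> diffs" "w \<in> diffs"
  shows "diff_class z \<oplus>\<^bsub>groth_ring R\<^esub> diff_class w = diff_class (z + w)"
  unfolding groth_ring_def ring_record_simps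
proof (rule UN_diff_class[OF assms])
  fix m n p q assume M: "m \<in> M" "n \<in> M" "p \<in> M" "q \<in> M" and eq: "m - n = z" "p - q = w"
  have "z + w = (m + p) - (n + q)" unfolding eq[symmetric] by simp
  thus "groth_rel R `` {(c m \<oplus> c p, c n \<oplus> c q)} = diff_class (z + w)"
    using groth_rel_class[OF M_add[OF M(1,3)] M_add[OF M(2,4)]] M by (simp only: add)
qed

lemma groth_mult:
  assumes "z \<in> diffs" "w \<in> diffs"
  shows "diff_class z \<otimes>\<^bsub>groth_ring R\<^esub> diff_class w = diff_class (z * w)"
  unfolding groth_ring_def ring_record_simps monoid.simps
proof (rule UN_diff_class[OF assms])
  fix m n p q assume M: "m \<in> M" "n \<in> M" "p \<in> M" "q \<in> M" and eq: "m - n = z" "p - q = w"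
  have "z * w = (m * p + n * q) - (m * q + n * p)"
    unfolding eq[symmetric] by (simp add: algebra_simps)
  moreover have "c m \<otimes> c p \<oplus> c n \<otimes> c q = c (m * p + n * q)"
    "c m \<otimes> c q \<oplus> c n \<otimes> c p = c (m * q + n * p)"
    using M by (simp_all add: add mult M_mult)
  ultimately show "groth_rel R `` {(c m \<otimes> c p \<oplus> c n \<otimes> c q, c m \<otimes> c q \<oplus> c n \<otimes> c p)}
      = diff_class (z * w)"
    using groth_rel_class[OF M_add[OF M_mult[OF M(1,3)] M_mult[OF M(2,4)]]
        M_add[OF M_mult[OF M(1,4)] M_mult[OF M(2,3)]]] by (simp only:)
qed

lemma cring_groth_ring: "cring (groth_ring R)"
proof -
  note ops = groth_zero groth_one groth_add groth_mult diffs_add diffs_mult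
  have z: "0 \<in> diffs" "1 \<in> diffs" using M_subset_diffs M_zero M_one by auto
  have "\<exists>y\<in>diff_class ` diffs. y \<oplus>\<^bsub>groth_ring R\<^esub> diff_class x = diff_class 0" if "x \<in> diffs" for x
    using that by (intro bexI[of _ "diff_class (- x)"]) (auto simp: groth_add diffs_uminus)
  hence "abelian_group (groth_ring R)"
    by (intro abelian_groupI) (auto simp: groth_carrier ops z algebra_simps)
  moreover have "comm_monoid (groth_ring R)"
    by (rule comm_monoidI) (auto simp: groth_carrier ops z algebra_simps)
  ultimately show ?thesis
    by (rule cringI) (auto simp: groth_carrier ops z algebra_simps)
qed

lemma groth_uminus:
  assumes "z \<in> diffs"
  shows "\<ominus>\<^bsub>groth_ring R\<^esub> diff_class z = diff_class (- z)"
proof -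
  interpret Q: cring "groth_ring R" by (rule cring_groth_ring)
  show ?thesis
    using assms diffs_uminus[OF assms]
    by (intro Q.minus_equality) (auto simp: groth_carrier groth_add groth_zero)
qed

end

section \<open>The Burnside ring as a ring of mark functions\<close>

context finite_group
begin

lemma UN_mark_class:
  assumes "m \<in> gset_marks G" "n \<in> gset_marks G"
    and "\<And>X \<phi> Y \<psi>. finite X \<Longrightarrow> group_action G X \<phi> \<Longrightarrow> mark G X \<phi> = m \<Longrightarrow>
      finite Y \<Longrightarrow> group_action G Y \<psi> \<Longrightarrow> mark G Y \<psi> = n \<Longrightarrow> f X \<phi> Y \<psi> = C"
  shows "(\<Union>(X, \<phi>) \<in> mark_class G m. \<Union>(Y, \<psi>) \<in> mark_class G n. f X \<phi> Y \<psi>) = C"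
proof (rule SUP_eq_const[OF mark_class_nonempty[OF assms(1)]])
  fix a assume "a \<in> mark_class G m"
  then obtain X \<phi> where "finite X" "group_action G X \<phi>" "mark G X \<phi> = m" "a = (X, \<phi>)"
    by (auto simp: mark_class_def)
  hence "(\<Union>(Y, \<psi>) \<in> mark_class G n. f X \<phi> Y \<psi>) = C"
    by (intro SUP_eq_const[OF mark_class_nonempty[OF assms(2)]])
      (auto simp: mark_class_def assms(3))
  thus "(case a of (X, \<phi>) \<Rightarrow> \<Union>(Y, \<psi>) \<in> mark_class G n. f X \<phi> Y \<psi>) = C"
    using \<open>a = (X, \<phi>)\<close> by simp
qed

sublocale gset: semiring_in_ring "gset_semiring G" "mark_class G" "gset_marks G"
proof
  have point: "group_action G {0 :: nat} (\<lambda>g. \<lambda>x \<in> {0}. x)"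
    by (rule group_actionI[OF is_group]) auto
  have empty: "group_action G ({} :: nat set) (\<lambda>g. \<lambda>x \<in> {}. x)"
    by (rule group_actionI[OF is_group]) (simp_all add: restrict_def extensional_def)
  have mp: "mark G {0 :: nat} (\<lambda>g. \<lambda>x \<in> {0}. x) = 1"
  proof
    fix K
    have "fixed_points G {0 :: nat} (\<lambda>g. \<lambda>x \<in> {0}. x) K = {0}" by (auto simp: fixed_points_def)
    thus "mark G {0 :: nat} (\<lambda>g. \<lambda>x \<in> {0}. x) K = 1 K" by (simp add: mark_def)
  qed
  have me: "mark G ({} :: nat set) (\<lambda>g. \<lambda>x \<in> {}. x) = 0"
    by (rule ext) (simp add: mark_def fixed_points_def)
  show "0 \<in> gset_marks G" using mark_in_gset_marks[OF empty] me by simp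
  show "1 \<in> gset_marks G" using mark_in_gset_marks[OF point] mp by simp
  show "\<zero>\<^bsub>gset_semiring G\<^esub> = mark_class G 0"
    using gset_class_eq[OF empty] me by (simp add: gset_semiring_def)
  show "\<one>\<^bsub>gset_semiring G\<^esub> = mark_class G 1"
    using gset_class_eq[OF point] mp by (simp add: gset_semiring_def)
  show "carrier (gset_semiring G) = mark_class G ` gset_marks G"
    by (force simp: gset_semiring_def gset_marks_def gset_class_eq)
  show "inj_on (mark_class G) (gset_marks G)" by (rule inj_mark_class)
  fix m n assume m: "m \<in> gset_marks G" and n: "n \<in> gset_marks G"
  obtain X :: "nat set" and \<phi> where X: "finite X" "group_action G X \<phi>" "m = mark G X \<phi>"
    using m by (auto simp: gset_marks_def)
  obtain Y :: "nat set" and \<psi> where Y: "finite Y" "group_action G Y \<psi>" "n = mark G Y \<psi>"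
    using n by (auto simp: gset_marks_def)
  show "m + n \<in> gset_marks G"
    using mark_in_gset_marks[OF group_action_sum[OF X(2) Y(2)]] X Y by (simp add: mark_sum_action)
  show "m * n \<in> gset_marks G"
    using mark_in_gset_marks[OF group_action_prod[OF X(2) Y(2)]] X Y by (simp add: mark_prod_action)
  show "mark_class G m \<oplus>\<^bsub>gset_semiring G\<^esub> mark_class G n = mark_class G (m + n)"
    unfolding gset_semiring_def ring_record_simps
    by (rule UN_mark_class[OF m n])
      (simp add: gset_class_eq group_action_sum mark_sum_action)
  show "mark_class G m \<otimes>\<^bsub>gset_semiring G\<^esub> mark_class G n = mark_class G (m * n)"
    unfolding gset_semiring_def ring_record_simps monoid.simps
    by (rule UN_mark_class[OF m n])
      (simp add: gset_class_eq group_action_prod mark_prod_action)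
qed

abbreviation burnside_marks :: "('a set \<Rightarrow> int) set" where
  "burnside_marks \<equiv> gset.diffs"

abbreviation burnside_of :: "('a set \<Rightarrow> int) \<Rightarrow> 'a burnside_elt" where
  "burnside_of \<equiv> gset.diff_class"

lemmas burnside_carrier = gset.groth_carrier[folded burnside_ring_def]
  and burnside_zero = gset.groth_zero[folded burnside_ring_def]
  and burnside_one = gset.groth_one[folded burnside_ring_def]
  and burnside_add = gset.groth_add[folded burnside_ring_def]
  and burnside_mult = gset.groth_mult[folded burnside_ring_def]
  and burnside_uminus = gset.groth_uminus[folded burnside_ring_def]
  and cring_burnside = gset.cring_groth_ring[folded burnside_ring_def]

lemma basis_mark_in_marks: "subgroup H G \<Longrightarrow> basis_mark G H \<in> gset_marks G"
  unfolding basis_mark_def by (intro mark_in_gset_marks group_action_coset finite_lcosets)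

lemma burnside_basis_eq:
  assumes "subgroup H G"
  shows "burnside_basis G H = burnside_of (basis_mark G H)"
  using gset.groth_of_class[OF basis_mark_in_marks[OF assms]]
    gset_class_eq[OF group_action_coset[OF assms] finite_lcosets]
  by (simp add: burnside_basis_def basis_mark_def)

lemma mark_span_subset_marks:
  assumes "\<forall>F\<in>\<E>. subgroup F G"
  shows "mark_span G \<E> \<subseteq> burnside_marks"
proof (rule mark_span_least)
  show "0 \<in> burnside_marks" using gset.M_subset_diffs gset.M_zero by blast
  show "basis_mark G F \<in> burnside_marks" if "F \<in> \<E>" for F
    using gset.M_subset_diffs basis_mark_in_marks[OF bspec[OF assms that]] by blast
qed (rule gset.diffs_add gset.diffs_uminus; assumption)+

lemma burnside_span_eq:
  assumes "\<forall>F\<in>\<E>. subgroup F G" "finite \<E>"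
  shows "burnside_span G \<E> = burnside_of ` mark_span G \<E>"
proof -
  interpret B: cring "burnside_ring G" by (rule cring_burnside)
  let ?A = "add_monoid (burnside_ring G)"
  have marks: "f \<in> burnside_marks" if "f \<in> mark_span G \<E>" for f
    using mark_span_subset_marks[OF assms(1)] that by blast
  have zero: "0 \<in> burnside_marks" using gset.M_subset_diffs gset.M_zero by blast
  have basis: "burnside_basis G F = burnside_of (basis_mark G F)"
    "basis_mark G F \<in> mark_span G \<E>" if "F \<in> \<E>" for F
    using burnside_basis_eq[OF bspec[OF assms(1) that]] basis_mark_in_span[OF assms(2) that] by auto
  have sub: "burnside_basis G ` \<E> \<subseteq> carrier ?A"
    using basis marks by (auto simp: burnside_carrier)
  let ?W = "generate ?A (burnside_basis G ` \<E>)"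
  have "x \<in> burnside_of ` mark_span G \<E>" if "x \<in> ?W" for x
    using that
  proof (induction rule: generate.induct)
    case one
    show ?case using mark_span_zero[of G \<E>] by (auto simp: burnside_zero)
  next
    case (incl h)
    thus ?case using basis by auto
  next
    case (inv h)
    then obtain F where F: "F \<in> \<E>" "h = burnside_basis G F" by blast
    have "inv\<^bsub>?A\<^esub> h = burnside_of (- basis_mark G F)"
      using burnside_uminus[OF marks[OF basis(2)[OF F(1)]]] basis(1)[OF F(1)] F(2)
      by (simp add: a_inv_def)
    thus ?case using mark_span_uminus basis(2)[OF F(1)] by blast
  next
    case (eng h1 h2)
    then obtain f g where fg: "f \<in> mark_span G \<E>" "g \<in> mark_span G \<E>"
      and h: "h1 = burnside_of f" "h2 = burnside_of g" by blast
    have "h1 \<otimes>\<^bsub>?A\<^esub> h2 = burnside_of (f + g)"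
      unfolding h using burnside_add[OF marks[OF fg(1)] marks[OF fg(2)]] by simp
    thus ?case using mark_span_add[OF fg] by blast
  qed
  moreover have "mark_span G \<E> \<subseteq> {f \<in> burnside_marks. burnside_of f \<in> ?W}"
  proof (rule mark_span_least; (intro CollectI conjI)?)
    show "burnside_of 0 \<in> ?W"
      using generate.one[of ?A "burnside_basis G ` \<E>"] by (simp only: burnside_zero monoid.simps)
  next
    fix f assume f: "f \<in> {f \<in> burnside_marks. burnside_of f \<in> ?W}"
    hence fm: "f \<in> burnside_marks" and fW: "burnside_of f \<in> ?W" by simp_all
    show "- f \<in> burnside_marks" by (rule gset.diffs_uminus[OF fm])
    show "burnside_of (- f) \<in> ?W"
      using group.generate_m_inv_closed[OF B.a_group sub fW]
      unfolding burnside_uminus[OF fm, symmetric] a_inv_def .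
    fix g assume "g \<in> {f \<in> burnside_marks. burnside_of f \<in> ?W}"
    hence gm: "g \<in> burnside_marks" and gW: "burnside_of g \<in> ?W" by simp_all
    show "f + g \<in> burnside_marks" by (rule gset.diffs_add[OF fm gm])
    show "burnside_of (f + g) \<in> ?W"
      using generate.eng[OF fW gW] burnside_add[OF fm gm] by simp
  next
    fix F assume F: "F \<in> \<E>"
    show "basis_mark G F \<in> burnside_marks" by (rule marks[OF basis(2)[OF F]])
    show "burnside_of (basis_mark G F) \<in> ?W"
      unfolding basis(1)[OF F, symmetric] using F by (intro generate.incl) blast
  qed (rule zero)
  ultimately show ?thesis unfolding burnside_span_def by blast
qed

lemma inj_burnside_of: "inj_on burnside_of burnside_marks"
  by (rule gset.inj_diff_class)

lemma burnside_bar_eq: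
  assumes "\<forall>F\<in>\<E>. subgroup F G" "finite \<E>"
  shows "burnside_bar G \<E> = burnside_of ` mark_bar G \<E>"
proof -
  interpret B: cring "burnside_ring G" by (rule cring_burnside)
  have key: "burnside_of f [^]\<^bsub>burnside_ring G\<^esub> (2::nat) \<oplus>\<^bsub>burnside_ring G\<^esub> add_pow (burnside_ring G) (2::nat) (burnside_of f)
      = \<zero>\<^bsub>burnside_ring G\<^esub> \<longleftrightarrow> f * f + (f + f) = 0" if f: "f \<in> burnside_marks" for f
  proof -
    let ?x = "burnside_of f"
    have c: "?x \<in> carrier (burnside_ring G)" using f by (simp add: burnside_carrier)
    have "?x [^]\<^bsub>burnside_ring G\<^esub> (2::nat) = burnside_of (f * f)"
      using c f by (simp add: numeral_2_eq_2 burnside_mult)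
    moreover have "add_pow (burnside_ring G) (2::nat) ?x = burnside_of (f + f)"
      using c f by (simp add: numeral_2_eq_2 burnside_add)
    ultimately have "?x [^]\<^bsub>burnside_ring G\<^esub> (2::nat) \<oplus>\<^bsub>burnside_ring G\<^esub> add_pow (burnside_ring G) (2::nat) ?x
      = burnside_of (f * f + (f + f))"
      using burnside_add[OF gset.diffs_mult[OF f f] gset.diffs_add[OF f f]] by simp
    moreover have "f * f + (f + f) \<in> burnside_marks"
      using f by (intro gset.diffs_add gset.diffs_mult)
    moreover have "0 \<in> burnside_marks" using gset.M_subset_diffs gset.M_zero by blast
    ultimately show ?thesis using inj_on_eq_iff[OF inj_burnside_of] by (metis burnside_zero)
  qed
  have marks: "f \<in> burnside_marks" if "f \<in> mark_span G \<E>" for f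
    using mark_span_subset_marks[OF assms(1)] that by blast
  show ?thesis
  proof (intro equalityI subsetI)
    fix x assume x: "x \<in> burnside_bar G \<E>"
    then obtain f where f: "f \<in> mark_span G \<E>" "x = burnside_of f"
      unfolding burnside_bar_def burnside_span_eq[OF assms] by blast
    hence "f \<in> mark_bar G \<E>"
      using x key[OF marks[OF f(1)]] by (simp only: burnside_bar_def mark_bar_def mem_Collect_eq)
    thus "x \<in> burnside_of ` mark_bar G \<E>" unfolding f(2) by (rule imageI)
  next
    fix x assume "x \<in> burnside_of ` mark_bar G \<E>"
    then obtain f where f: "f \<in> mark_span G \<E>" "f * f + (f + f) = 0" "x = burnside_of f"
      unfolding mark_bar_def by blast
    thus "x \<in> burnside_bar G \<E>"
      using key[OF marks[OF f(1)]] unfolding burnside_bar_def burnside_span_eq[OF assms] by simp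
  qed
qed

text \<open>
  An invertible integer function has values 1 and -1 and so is its own inverse; an inverse therefore
  lies in the same span.
\<close>

lemma Units_burnside_subring:
  assumes "\<forall>F\<in>\<D>. subgroup F G" "finite \<D>"
  shows "Units (burnside_subring G \<D>) = burnside_of ` mark_units G \<D>"
proof -
  have marks: "f \<in> burnside_marks" if "f \<in> mark_span G \<D>" for f
    using mark_span_subset_marks[OF assms(1)] that by blast
  have one: "1 \<in> burnside_marks" using gset.M_subset_diffs gset.M_one by blast
  have mult: "burnside_of f \<otimes>\<^bsub>burnside_ring G\<^esub> burnside_of g = \<one>\<^bsub>burnside_ring G\<^esub> \<longleftrightarrow> f * g = 1"
    if "f \<in> mark_span G \<D>" "g \<in> mark_span G \<D>" for f g
    using marks[OF that(1)] marks[OF that(2)] inj_on_eq_iff[OF inj_burnside_of gset.diffs_mult one]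
    by (simp add: burnside_mult burnside_one)
  have sq: "f * f = 1" if "g * f = 1" for f g :: "'a set \<Rightarrow> int"
  proof
    fix K
    have "g K * f K = 1" using that by (metis one_fun_apply times_fun_apply)
    thus "(f * f) K = 1 K" by (auto simp: zmult_eq_1_iff)
  qed
  show ?thesis
    unfolding Units_def mark_units_def
    using mult sq by (auto simp: burnside_subring_def burnside_span_eq[OF assms] image_iff)
qed

end

section \<open>Inverting the table of marks\<close>

context finite_group
begin

lemma conj_subgroup_conj:
  assumes "H \<subseteq> carrier G" "g \<in> carrier G" "h \<in> carrier G"
  shows "conj_subgroup G g (conj_subgroup G h H) = conj_subgroup G (g \<otimes> h) H"
  unfolding conj_subgroup_eq_image image_image
  by (rule image_cong) (use assms in \<open>auto simp: inv_mult_group m_assoc subset_iff\<close>)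

lemma equiv_conj_rel:
  assumes "closed_family G \<E>"
  shows "equiv \<E> (conj_rel G \<E>)"
proof (rule equivI)
  have sub: "subgroup H G" "H \<subseteq> carrier G" if "H \<in> \<E>" for H
    using that assms subgroup.subset by (auto simp: closed_family_def)
  show "conj_rel G \<E> \<subseteq> \<E> \<times> \<E>" by (auto simp: conj_rel_def)
  show "refl_on \<E> (conj_rel G \<E>)"
    using sub conj_subgroup_one by (auto simp: refl_on_def conj_rel_def intro!: bexI[of _ \<one>])
  show "sym (conj_rel G \<E>)"
  proof (rule symI)
    fix H K assume "(H, K) \<in> conj_rel G \<E>"
    then obtain g where g: "H \<in> \<E>" "K \<in> \<E>" "g \<in> carrier G" "K = conj_subgroup G g H"
      by (auto simp: conj_rel_def)
    have "conj_subgroup G (inv g) K = H"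
      using g sub by (simp add: conj_subgroup_conj conj_subgroup_one)
    thus "(K, H) \<in> conj_rel G \<E>" using g by (auto simp: conj_rel_def intro!: bexI[of _ "inv g"])
  qed
  show "trans (conj_rel G \<E>)"
  proof (rule transI)
    fix H K L assume "(H, K) \<in> conj_rel G \<E>" "(K, L) \<in> conj_rel G \<E>"
    then obtain g h where g: "H \<in> \<E>" "L \<in> \<E>" "g \<in> carrier G" "h \<in> carrier G"
      "L = conj_subgroup G h (conj_subgroup G g H)"
      by (auto simp: conj_rel_def)
    hence "L = conj_subgroup G (h \<otimes> g) H" using sub by (simp add: conj_subgroup_conj)
    thus "(H, L) \<in> conj_rel G \<E>" using g by (auto simp: conj_rel_def)
  qed
qed

end

locale conj_representatives = finite_group +
  fixes \<E> :: "'a set set" and Hs :: "'a set list"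
  assumes closed: "closed_family G \<E>" and reps: "conj_reps G \<E> Hs"
begin

abbreviation r :: nat where "r \<equiv> length Hs"

lemma Hs_in: "i < r \<Longrightarrow> Hs ! i \<in> \<E>"
  using reps by (auto simp: conj_reps_def)

lemma subgroup_E: "F \<in> \<E> \<Longrightarrow> subgroup F G"
  using closed by (simp add: closed_family_def)

lemma finite_E: "finite \<E>"
  by (rule closed_family_finite[OF closed])

lemma subset_E: "F \<in> \<E> \<Longrightarrow> F \<subseteq> carrier G"
  using subgroup_E subgroup.subset by blast

lemma rep_unique:
  assumes "i < r" "j < r" "(Hs ! i, Hs ! j) \<in> conj_rel G \<E>"
  shows "i = j"
proof -
  let ?C = "conj_rel G \<E> `` {Hs ! i}"
  have "?C \<in> \<E> // conj_rel G \<E>" by (rule quotientI[OF Hs_in[OF assms(1)]])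
  hence "\<exists>!H. H \<in> set Hs \<and> H \<in> ?C" using reps unfolding conj_reps_def by blast
  moreover have "Hs ! i \<in> ?C"
    using equiv_class_self[OF equiv_conj_rel[OF closed] Hs_in[OF assms(1)]] .
  moreover have "Hs ! j \<in> ?C" using assms(3) by simp
  ultimately have "Hs ! i = Hs ! j" using assms(1,2) nth_mem by blast
  thus ?thesis using reps assms(1,2) by (simp add: conj_reps_def nth_eq_iff_index_eq)
qed

lemma rep_exists:
  assumes "F \<in> \<E>"
  obtains i g where "i < r" "g \<in> carrier G" "F = conj_subgroup G g (Hs ! i)"
proof -
  let ?C = "conj_rel G \<E> `` {F}"
  have "?C \<in> \<E> // conj_rel G \<E>" by (rule quotientI[OF assms])
  hence "\<exists>!H. H \<in> set Hs \<and> H \<in> ?C" using reps unfolding conj_reps_def by blast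
  then obtain i where i: "i < r" "(F, Hs ! i) \<in> conj_rel G \<E>" by (auto simp: in_set_conv_nth)
  hence "(Hs ! i, F) \<in> conj_rel G \<E>"
    using equiv_conj_rel[OF closed] by (meson equivE symE)
  thus ?thesis using i that by (auto simp: conj_rel_def)
qed

lemma num_conj_classes_eq: "num_conj_classes G \<E> = r"
proof -
  have "bij_betw (\<lambda>i. conj_rel G \<E> `` {Hs ! i}) {..<r} (\<E> // conj_rel G \<E>)"
    unfolding bij_betw_def
  proof
    show "inj_on (\<lambda>i. conj_rel G \<E> `` {Hs ! i}) {..<r}"
      using rep_unique eq_equiv_class[OF _ equiv_conj_rel[OF closed] Hs_in]
      by (auto intro!: inj_onI)
    show "(\<lambda>i. conj_rel G \<E> `` {Hs ! i}) ` {..<r} = \<E> // conj_rel G \<E>"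
    proof
      show "(\<lambda>i. conj_rel G \<E> `` {Hs ! i}) ` {..<r} \<subseteq> \<E> // conj_rel G \<E>"
        using Hs_in by (auto intro: quotientI)
      show "\<E> // conj_rel G \<E> \<subseteq> (\<lambda>i. conj_rel G \<E> `` {Hs ! i}) ` {..<r}"
      proof
        fix C assume "C \<in> \<E> // conj_rel G \<E>"
        then obtain F where F: "F \<in> \<E>" "C = conj_rel G \<E> `` {F}" by (auto elim: quotientE)
        obtain i g where i: "i < r" "g \<in> carrier G" "F = conj_subgroup G g (Hs ! i)"
          using rep_exists[OF F(1)] .
        hence "(Hs ! i, F) \<in> conj_rel G \<E>" using F Hs_in by (auto simp: conj_rel_def)
        hence "C = conj_rel G \<E> `` {Hs ! i}"
          using F equiv_class_eq[OF equiv_conj_rel[OF closed]] by blast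
        thus "C \<in> (\<lambda>i. conj_rel G \<E> `` {Hs ! i}) ` {..<r}" using i by auto
      qed
    qed
  qed
  thus ?thesis unfolding num_conj_classes_def using bij_betw_same_card by fastforce
qed

abbreviation M :: "rat mat" where "M \<equiv> table_of_marks G Hs"

lemma M_carrier: "M \<in> carrier_mat r r"
  by (simp add: table_of_marks_def)

lemma M_entry:
  assumes "i < r" "j < r"
  shows "M $$ (i, j) = of_int (basis_mark G (Hs ! j) (Hs ! i))"
proof -
  have "Hs ! i \<inter> carrier G = Hs ! i" using subset_E[OF Hs_in[OF assms(1)]] by auto
  thus ?thesis
    using assms by (simp add: table_of_marks_def basis_mark_def mark_def fixed_points_def)
qed

lemma M_mult_vec:
  assumes "v \<in> carrier_vec r" "i < r"
  shows "(M *\<^sub>v v) $ i = (\<Sum>j<r. of_int (basis_mark G (Hs ! j) (Hs ! i)) * v $ j)"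
  using assms M_carrier
  by (auto simp: scalar_prod_def M_entry atLeast0LessThan intro!: sum.cong)

text \<open>
  Triangularity without an ordering: among the indices where \<open>v\<close> does not vanish, choose \<open>i\<close> such that
  the \<open>i\<close>-th representative is largest. A nonzero entry of \<open>M\<close> in row \<open>i\<close> and another such column \<open>j\<close>
  would place it inside a conjugate of the \<open>j\<close>-th one; by size they would be conjugate, so \<open>i = j\<close>.
  Hence row \<open>i\<close> gives \<open>M\<^sub>i\<^sub>i v\<^sub>i = 0\<close>, although \<open>M\<^sub>i\<^sub>i\<close> is nonzero.
\<close>

lemma M_kernel:
  assumes "v \<in> carrier_vec r" "M *\<^sub>v v = 0\<^sub>v r"
  shows "v = 0\<^sub>v r"
proof (rule ccontr)
  assume "v \<noteq> 0\<^sub>v r"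
  let ?J = "{j. j < r \<and> v $ j \<noteq> 0}"
  let ?c = "\<lambda>j. card (Hs ! j)"
  have "?J \<noteq> {}" using \<open>v \<noteq> 0\<^sub>v r\<close> assms(1) by (auto simp: vec_eq_iff)
  \<comment> \<open>A largest representative among those with nonzero coefficient.\<close>
  hence "Max (?c ` ?J) \<in> ?c ` ?J" by (intro Max_in) auto
  then obtain i where i: "i < r" "v $ i \<noteq> 0" and "?c i = Max (?c ` ?J)" by auto
  hence max: "?c j \<le> ?c i" if "j < r" "v $ j \<noteq> 0" for j using that by simp
  have Hi: "Hs ! i \<subseteq> carrier G" "finite (Hs ! i)"
    using subset_E[OF Hs_in[OF i(1)]] finite_carrier finite_subset by auto
  have zero: "of_int (basis_mark G (Hs ! j) (Hs ! i)) * v $ j = 0" if jr: "j < r" and ji: "j \<noteq> i" for j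
  proof (rule ccontr)
    assume nz: "of_int (basis_mark G (Hs ! j) (Hs ! i)) * v $ j \<noteq> 0"
    hence "basis_mark G (Hs ! j) (Hs ! i) \<noteq> 0" and vj: "v $ j \<noteq> 0" by auto
    then obtain g where g: "g \<in> carrier G" "Hs ! i \<subseteq> conj_subgroup G g (Hs ! j)"
      using basis_mark_nonzero_iff[OF subgroup_E[OF Hs_in[OF jr]], of "Hs ! i"] Hi
      by (auto simp: Int_absorb2)
    have Hj: "Hs ! j \<subseteq> carrier G" using subset_E[OF Hs_in[OF jr]] .
    have fin: "finite (conj_subgroup G g (Hs ! j))"
      using conj_subgroup_carrier[OF Hj g(1)] finite_carrier finite_subset by blast
    have "card (conj_subgroup G g (Hs ! j)) \<le> card (Hs ! i)"
      using card_conj_subgroup[OF Hj g(1)] max[OF jr vj] by simp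
    hence "Hs ! i = conj_subgroup G g (Hs ! j)" by (rule card_seteq[OF fin g(2)])
    hence "(Hs ! j, Hs ! i) \<in> conj_rel G \<E>"
      using Hs_in[OF i(1)] Hs_in[OF jr] g(1) by (auto simp: conj_rel_def)
    thus False using rep_unique[OF jr i(1)] ji by simp
  qed
  have "(M *\<^sub>v v) $ i = of_int (basis_mark G (Hs ! i) (Hs ! i)) * v $ i +
      (\<Sum>j\<in>{..<r} - {i}. of_int (basis_mark G (Hs ! j) (Hs ! i)) * v $ j)"
    unfolding M_mult_vec[OF assms(1) i(1)] using i(1) by (intro sum.remove) auto
  also have "(\<Sum>j\<in>{..<r} - {i}. of_int (basis_mark G (Hs ! j) (Hs ! i)) * v $ j) = 0"
    by (intro sum.neutral ballI zero) auto
  finally have "basis_mark G (Hs ! i) (Hs ! i) = 0" using assms(2) i by simp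
  moreover have "Hs ! i \<inter> carrier G \<subseteq> conj_subgroup G \<one> (Hs ! i)"
    using conj_subgroup_one[OF subgroup_E[OF Hs_in[OF i(1)]]] by auto
  ultimately show False
    using basis_mark_nonzero_iff[OF subgroup_E[OF Hs_in[OF i(1)]], of "Hs ! i"] by blast
qed

lemma M_inverse:
  obtains B where "mat_inverse M = Some B" "B \<in> carrier_mat r r" "B * M = 1\<^sub>m r" "M * B = 1\<^sub>m r"
proof -
  have "det M \<noteq> 0" using det_0_iff_vec_prod_zero[OF M_carrier] M_kernel by blast
  hence "M \<in> Units (ring_mat TYPE(rat) r ())" by (rule det_non_zero_imp_unit[OF M_carrier])
  then obtain B where "mat_inverse M = Some B"
    using mat_inverse(1)[OF M_carrier] by (metis not_None_eq)
  thus ?thesis using mat_inverse(2)[OF M_carrier] that by blast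
qed

lemma integral_preimages_eq:
  "integral_preimages r M = {v \<in> carrier_vec r. (\<forall>i<r. v $ i \<in> \<int>) \<and> (\<forall>i<r. (M *\<^sub>v v) $ i \<in> {0, -2})}"
proof -
  obtain B where B: "mat_inverse M = Some B" "B \<in> carrier_mat r r" "B * M = 1\<^sub>m r" "M * B = 1\<^sub>m r"
    by (rule M_inverse)
  have MB: "M *\<^sub>v (B *\<^sub>v w) = w" "B *\<^sub>v (M *\<^sub>v w) = w" if "w \<in> carrier_vec r" for w
    using assoc_mult_mat_vec[OF M_carrier B(2) that] assoc_mult_mat_vec[OF B(2) M_carrier that] B that
    by simp_all
  show ?thesis
  proof (intro equalityI subsetI)
    fix v assume "v \<in> integral_preimages r M"
    then obtain w where "w \<in> carrier_vec r" "\<forall>i<r. w $ i \<in> {0, -2}" "v = B *\<^sub>v w"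
      "v \<in> carrier_vec r" "\<forall>i<r. v $ i \<in> \<int>"
      by (auto simp: integral_preimages_def B(1))
    thus "v \<in> {v \<in> carrier_vec r. (\<forall>i<r. v $ i \<in> \<int>) \<and> (\<forall>i<r. (M *\<^sub>v v) $ i \<in> {0, -2})}"
      using MB by simp
  next
    fix v assume v: "v \<in> {v \<in> carrier_vec r. (\<forall>i<r. v $ i \<in> \<int>) \<and> (\<forall>i<r. (M *\<^sub>v v) $ i \<in> {0, -2})}"
    hence "v = B *\<^sub>v (M *\<^sub>v v)" "M *\<^sub>v v \<in> carrier_vec r"
      using MB M_carrier by auto
    thus "v \<in> integral_preimages r M"
      using v unfolding integral_preimages_def B(1) option.sel by blast
  qed
qed

text \<open>
  Taking integer parts only serves to have integer coefficients; the map is used for vectors with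
  integral entries.
\<close>

definition combination :: "rat vec \<Rightarrow> 'a set \<Rightarrow> int" where
  "combination v = (\<lambda>K. \<Sum>j<r. \<lfloor>v $ j\<rfloor> * basis_mark G (Hs ! j) K)"

lemma combination_span: "combination v \<in> mark_span G \<E>"
  unfolding combination_def
  by (intro mark_span_lincomb basis_mark_in_span finite_E Hs_in) simp

lemma combination_at_rep:
  assumes "v \<in> carrier_vec r" "\<forall>i<r. v $ i \<in> \<int>" "i < r"
  shows "of_int (combination v (Hs ! i)) = (M *\<^sub>v v) $ i"
  unfolding M_mult_vec[OF assms(1,3)] combination_def of_int_sum
  by (rule sum.cong) (use assms(2) in \<open>auto simp: mult.commute\<close>)

lemma combination_bar_iff:
  assumes "v \<in> carrier_vec r" "\<forall>i<r. v $ i \<in> \<int>"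
  shows "combination v \<in> mark_bar G \<E> \<longleftrightarrow> (\<forall>i<r. (M *\<^sub>v v) $ i \<in> {0, -2})"
proof -
  have iff: "combination v (Hs ! i) \<in> {0, -2} \<longleftrightarrow> (M *\<^sub>v v) $ i \<in> {0, -2}" if "i < r" for i
  proof -
    have "(of_int (combination v (Hs ! i)) :: rat) \<in> {0, -2} \<longleftrightarrow> combination v (Hs ! i) \<in> {0, -2}"
      using of_int_eq_iff[of "combination v (Hs ! i)" "-2", where 'a = rat] by auto
    thus ?thesis using combination_at_rep[OF assms that] by simp
  qed
  have "combination v F \<in> {0, -2}"
    if h: "\<forall>i<r. combination v (Hs ! i) \<in> {0, -2}" and F: "F \<in> \<E>" for F
  proof -
    obtain i g where i: "i < r" "g \<in> carrier G" "F = conj_subgroup G g (Hs ! i)"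
      using rep_exists[OF F] .
    have "combination v F = combination v (Hs ! i)"
      unfolding i(3) using i subset_E[OF Hs_in[OF i(1)]] subgroup_E
      by (intro mark_span_conj[OF _ combination_span]) auto
    thus ?thesis using h i by simp
  qed
  hence "combination v \<in> mark_bar G \<E> \<longleftrightarrow> (\<forall>i<r. combination v (Hs ! i) \<in> {0, -2})"
    unfolding mark_bar_iff
    using mark_span_values[OF closed combination_span, of "{0, -2}"] combination_span by blast
  thus ?thesis using iff by blast
qed

text \<open>
  Conjugate subgroups have equal basis marks, so the coefficients over each conjugacy class can be
  added up.
\<close>

lemma span_combination:
  assumes "f \<in> mark_span G \<E>"
  obtains v where "v \<in> carrier_vec r" "\<forall>i<r. v $ i \<in> \<int>" "f = combination v"
proof -
  obtain a where f: "f = (\<lambda>K. \<Sum>F\<in>\<E>. a F * basis_mark G F K)"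
    using assms by (auto simp: mark_span_def)
  have "\<forall>F\<in>\<E>. \<exists>i<r. basis_mark G F = basis_mark G (Hs ! i)"
    using rep_exists basis_mark_conj[OF subgroup_E[OF Hs_in]] by metis
  then obtain \<rho> where \<rho>: "\<And>F. F \<in> \<E> \<Longrightarrow> \<rho> F < r \<and> basis_mark G F = basis_mark G (Hs ! \<rho> F)"
    by metis
  define v where "v = vec r (\<lambda>j. of_int (\<Sum>F\<in>{F\<in>\<E>. \<rho> F = j}. a F) :: rat)"
  have "f K = combination v K" for K
  proof -
    have "f K = (\<Sum>j<r. \<Sum>F\<in>{F\<in>\<E>. \<rho> F = j}. a F * basis_mark G F K)"
      unfolding f by (rule sum.group[symmetric]) (use \<rho> finite_E in auto)
    also have "\<dots> = (\<Sum>j<r. (\<Sum>F\<in>{F\<in>\<E>. \<rho> F = j}. a F) * basis_mark G (Hs ! j) K)"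
      unfolding sum_distrib_right by (intro sum.cong refl) (use \<rho> in auto)
    also have "\<dots> = combination v K"
      unfolding combination_def v_def by (intro sum.cong refl) (simp del: of_int_sum)
    finally show ?thesis .
  qed
  hence "f = combination v" by (rule ext)
  moreover have "v \<in> carrier_vec r" "\<forall>i<r. v $ i \<in> \<int>" by (auto simp: v_def simp del: of_int_sum)
  ultimately show ?thesis using that by blast
qed

text \<open>
  Integral coordinate vectors of members of \<open>bar\<close> are those whose product with \<open>M\<close>, the vector of
  marks at the representatives, has entries in \<open>{0, -2}\<close>.
\<close>

theorem card_integral_preimages:
  "card (integral_preimages (num_conj_classes G \<E>) M) = card (mark_bar G \<E>)"
proof -
  have "bij_betw combination (integral_preimages r M) (mark_bar G \<E>)"
    unfolding bij_betw_def
  proof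
    show "inj_on combination (integral_preimages r M)"
    proof (rule inj_onI)
      fix v w assume v: "v \<in> integral_preimages r M" and w: "w \<in> integral_preimages r M"
        and eq: "combination v = combination w"
      have vw: "v \<in> carrier_vec r" "w \<in> carrier_vec r" "\<forall>i<r. v $ i \<in> \<int>" "\<forall>i<r. w $ i \<in> \<int>"
        using v w by (auto simp: integral_preimages_def)
      have Mvw: "M *\<^sub>v v = M *\<^sub>v w"
        by (rule eq_vecI)
          (use combination_at_rep[OF vw(1,3)] combination_at_rep[OF vw(2,4)] eq M_carrier in auto)
      obtain B where B: "B \<in> carrier_mat r r" "B * M = 1\<^sub>m r" by (rule M_inverse)
      have inv: "B *\<^sub>v (M *\<^sub>v z) = z" if "z \<in> carrier_vec r" for z
        using assoc_mult_mat_vec[OF B(1) M_carrier that] B(2) that by simp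
      show "v = w" using inv[OF vw(1)] inv[OF vw(2)] unfolding Mvw by (rule trans[OF sym])
    qed
    show "combination ` integral_preimages r M = mark_bar G \<E>"
    proof (intro equalityI subsetI)
      fix f assume "f \<in> combination ` integral_preimages r M"
      thus "f \<in> mark_bar G \<E>" unfolding integral_preimages_eq using combination_bar_iff by auto
    next
      fix f assume f: "f \<in> mark_bar G \<E>"
      hence "f \<in> mark_span G \<E>" by (simp add: mark_bar_def)
      then obtain v where v: "v \<in> carrier_vec r" "\<forall>i<r. v $ i \<in> \<int>" "f = combination v"
        by (rule span_combination)
      hence "\<forall>i<r. (M *\<^sub>v v) $ i \<in> {0, -2}" using combination_bar_iff[OF v(1,2)] f by blast
      thus "f \<in> combination ` integral_preimages r M" unfolding integral_preimages_eq using v by blast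
    qed
  qed
  thus ?thesis unfolding num_conj_classes_eq by (rule bij_betw_same_card)
qed

end

section \<open>Units of the partial Burnside ring\<close>

context graded_collection
begin

lemma subgroups_D: "\<forall>F\<in>\<D>. subgroup F G"
  using subgroup_D by blast

lemma span_D_marks: "f \<in> mark_span G \<D> \<Longrightarrow> f \<in> burnside_marks"
  using mark_span_subset_marks[OF subgroups_D] by blast

lemma mark_bar_in_D: "f \<in> mark_bar G (fam H) \<Longrightarrow> f \<in> mark_span G \<D>"
  using mark_span_mono[OF finite_D fam_subset] by (auto simp: mark_bar_def)

lemma Units_eq: "Units (burnside_subring G \<D>) = burnside_of ` mark_units G \<D>"
  using Units_burnside_subring[OF subgroups_D finite_D] .

lemma bar_eq: "burnside_bar G (fam H) = burnside_of ` mark_bar G (fam H)"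
  using fam_subset subgroup_D finite_subset[OF fam_subset finite_D]
  by (intro burnside_bar_eq) blast+

lemma card_bar: "card (burnside_bar G (fam H)) = card (mark_bar G (fam H))"
  unfolding bar_eq
  by (intro card_image inj_on_subset[OF inj_burnside_of]) (auto intro: span_D_marks mark_bar_in_D)

lemma card_Units: "card (Units (burnside_subring G \<D>)) = card (mark_units G \<D>)"
  unfolding Units_eq
  by (intro card_image inj_on_subset[OF inj_burnside_of]) (auto simp: mark_units_def span_D_marks)

definition bar_generators :: "'a burnside_elt set" where
  "bar_generators = {\<ominus>\<^bsub>burnside_ring G\<^esub> \<one>\<^bsub>burnside_ring G\<^esub>} \<union>
     (\<Union>H \<in> S. \<Union>x \<in> burnside_bar G (fam H) - {\<zero>\<^bsub>burnside_ring G\<^esub>}.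
       {\<one>\<^bsub>burnside_ring G\<^esub> \<oplus>\<^bsub>burnside_ring G\<^esub> x})"

lemma one_marks: "1 \<in> burnside_marks"
  using gset.M_subset_diffs gset.M_one by blast

lemma one_plus_in_units:
  assumes "f \<in> mark_bar G (fam H)"
  shows "1 + f \<in> mark_units G \<D>"
  using mark_bar_span_D[OF assms] mark_bar_square[OF assms] by (simp add: mark_units_def)

lemma bar_generators_subset: "bar_generators \<subseteq> Units (burnside_subring G \<D>)"
proof -
  have "- 1 \<in> mark_units G \<D>"
    using mark_span_uminus[OF one_in_mark_span[OF finite_D carrier_D]] by (simp add: mark_units_def)
  hence "\<ominus>\<^bsub>burnside_ring G\<^esub> \<one>\<^bsub>burnside_ring G\<^esub> \<in> Units (burnside_subring G \<D>)"
    unfolding Units_eq burnside_one burnside_uminus[OF one_marks] by blast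
  moreover have "\<one>\<^bsub>burnside_ring G\<^esub> \<oplus>\<^bsub>burnside_ring G\<^esub> x \<in> Units (burnside_subring G \<D>)"
    if x: "x \<in> burnside_bar G (fam H)" for x H
  proof -
    obtain f where f: "f \<in> mark_bar G (fam H)" "x = burnside_of f" using x unfolding bar_eq by blast
    have "\<one>\<^bsub>burnside_ring G\<^esub> \<oplus>\<^bsub>burnside_ring G\<^esub> x = burnside_of (1 + f)"
      unfolding f(2) burnside_one
      by (rule burnside_add[OF one_marks span_D_marks[OF mark_bar_in_D[OF f(1)]]])
    thus ?thesis unfolding Units_eq using one_plus_in_units[OF f(1)] by blast
  qed
  ultimately show ?thesis unfolding bar_generators_def by blast
qed

lemma monoid_burnside_subring: "monoid (burnside_subring G \<D>)"
proof -
  interpret B: cring "burnside_ring G" by (rule cring_burnside)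
  have span: "burnside_span G \<D> = burnside_of ` mark_span G \<D>"
    by (rule burnside_span_eq[OF subgroups_D finite_D])
  show ?thesis
  proof (rule monoidI)
    fix x y assume "x \<in> carrier (burnside_subring G \<D>)" "y \<in> carrier (burnside_subring G \<D>)"
    then obtain f g where "f \<in> mark_span G \<D>" "g \<in> mark_span G \<D>" "x = burnside_of f" "y = burnside_of g"
      by (auto simp: burnside_subring_def span)
    thus "x \<otimes>\<^bsub>burnside_subring G \<D>\<^esub> y \<in> carrier (burnside_subring G \<D>)"
      using mark_span_mult[OF closed_D] burnside_mult span_D_marks
      by (auto simp: burnside_subring_def span)
  next
    show "\<one>\<^bsub>burnside_subring G \<D>\<^esub> \<in> carrier (burnside_subring G \<D>)"
      using one_in_mark_span[OF finite_D carrier_D] by (auto simp: burnside_subring_def span burnside_one)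
  qed (use span_D_marks in \<open>auto simp: burnside_subring_def span B.m_assoc burnside_carrier\<close>)
qed

lemma generate_bar_generators:
  "generate (units_of (burnside_subring G \<D>)) bar_generators = Units (burnside_subring G \<D>)"
proof
  let ?R = "burnside_subring G \<D>"
  interpret U: group "units_of ?R" by (rule monoid.units_group[OF monoid_burnside_subring])
  show "generate (units_of ?R) bar_generators \<subseteq> Units ?R"
    using U.generate_incl[of bar_generators] bar_generators_subset by (simp add: units_of_carrier)
  show "Units ?R \<subseteq> generate (units_of ?R) bar_generators"
  proof
    fix y assume "y \<in> Units ?R"
    then obtain u where u: "u \<in> mark_units G \<D>" and y: "y = burnside_of u" unfolding Units_eq by blast
    obtain x where x: "x \<in> (\<Pi>\<^sub>E H\<in>S. mark_bar G (fam H))" and ux: "u = (\<Prod>H\<in>S. 1 + x H)"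
      using units_factor[OF u] .
    have bar: "x H \<in> mark_bar G (fam H)" if "H \<in> S" for H using x that by auto
    have one: "burnside_of 1 \<in> generate (units_of ?R) bar_generators"
      using generate.one[of "units_of ?R" bar_generators]
      by (simp add: units_of_one burnside_subring_def burnside_one)
    have gen: "burnside_of (1 + x H) \<in> generate (units_of ?R) bar_generators" if H: "H \<in> S" for H
    proof (cases "x H = 0")
      case True
      thus ?thesis using one by simp
    next
      case False
      have m: "x H \<in> burnside_marks" using span_D_marks mark_bar_in_D bar[OF H] by blast
      have "0 \<in> burnside_marks" using gset.M_subset_diffs gset.M_zero by blast
      hence "burnside_of (x H) \<noteq> \<zero>\<^bsub>burnside_ring G\<^esub>"
        using False inj_on_eq_iff[OF inj_burnside_of m] by (simp add: burnside_zero)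
      moreover have "burnside_of (x H) \<in> burnside_bar G (fam H)" unfolding bar_eq using bar[OF H] by blast
      moreover have "burnside_of (1 + x H) = \<one>\<^bsub>burnside_ring G\<^esub> \<oplus>\<^bsub>burnside_ring G\<^esub> burnside_of (x H)"
        using burnside_add[OF one_marks m] by (simp add: burnside_one)
      ultimately have "burnside_of (1 + x H) \<in> bar_generators"
        unfolding bar_generators_def using H by blast
      thus ?thesis by (rule generate.incl)
    qed
    have "burnside_of (\<Prod>H\<in>T. 1 + x H) \<in> generate (units_of ?R) bar_generators" if "T \<subseteq> S" for T
      using finite_subset[OF that finite_S] that
    proof (induction T rule: finite_induct)
      case empty
      show ?case unfolding prod.empty by (rule one)
    next
      case (insert H T)
      have m: "1 + x H \<in> burnside_marks" "(\<Prod>K\<in>T. 1 + x K) \<in> burnside_marks"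
        using insert.prems bar
        by (auto intro!: span_D_marks mark_span_prod mark_bar_span_D)
      have eq: "burnside_of (\<Prod>K\<in>insert H T. 1 + x K)
          = burnside_of (1 + x H) \<otimes>\<^bsub>units_of ?R\<^esub> burnside_of (\<Prod>K\<in>T. 1 + x K)"
        unfolding prod.insert[OF insert.hyps] using burnside_mult[OF m]
        by (simp add: units_of_mult burnside_subring_def)
      have HT: "H \<in> S" "T \<subseteq> S" using insert.prems by simp_all
      show ?case unfolding eq by (rule generate.eng[OF gen[OF HT(1)] insert.IH[OF HT(2)]])
    qed
    thus "y \<in> generate (units_of ?R) bar_generators" unfolding y ux by blast
  qed
qed

end

theorem theorem3p3:
  fixes G :: "('g, 'm) monoid_scheme"
    and \<D> S :: "'g set set"
  assumes "group G"
    and "finite (carrier G)"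
    and "collection G \<D>"
    and "basic_collection G S"
  shows
    "finite (Units (burnside_subring G \<D>)) \<and>
     card (Units (burnside_subring G \<D>))
       = 2 * (\<Prod>H \<in> S - {carrier G}. card (burnside_bar G (S_family \<D> S H))) \<and>
     (\<forall>reps. (\<forall>H \<in> S - {carrier G}. conj_reps G (S_family \<D> S H) (reps H)) \<longrightarrow>
        card (Units (burnside_subring G \<D>))
          = 2 * (\<Prod>H \<in> S - {carrier G}.
                   card (integral_preimages (num_conj_classes G (S_family \<D> S H))
                           (table_of_marks G (reps H))))) \<and>
     (let Gens = {\<ominus>\<^bsub>burnside_ring G\<^esub> \<one>\<^bsub>burnside_ring G\<^esub>} \<union>
              (\<Union>H \<in> S. \<Union>x \<in> burnside_bar G (S_family \<D> S H) - {\<zero>\<^bsub>burnside_ring G\<^esub>}.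
                 {\<one>\<^bsub>burnside_ring G\<^esub> \<oplus>\<^bsub>burnside_ring G\<^esub> x})
      in Gens \<subseteq> Units (burnside_subring G \<D>) \<and>
         generate (units_of (burnside_subring G \<D>)) Gens = Units (burnside_subring G \<D>))"
proof -
  interpret graded_collection G \<D> S
    using assms
    by (simp add: graded_collection_def finite_group_def finite_group_axioms_def
        graded_collection_axioms_def)
  have fin: "finite (Units (burnside_subring G \<D>))"
    unfolding Units_eq by (intro finite_imageI card_mark_units)
  have card: "card (Units (burnside_subring G \<D>))
       = 2 * (\<Prod>H \<in> S - {carrier G}. card (burnside_bar G (S_family \<D> S H)))"
    unfolding card_Units card_bar by (rule card_mark_units(2))
  have table: "card (Units (burnside_subring G \<D>))
          = 2 * (\<Prod>H \<in> S - {carrier G}.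
                   card (integral_preimages (num_conj_classes G (S_family \<D> S H))
                           (table_of_marks G (reps H))))"
    if reps: "\<forall>H \<in> S - {carrier G}. conj_reps G (S_family \<D> S H) (reps H)" for reps
  proof -
    have "card (burnside_bar G (S_family \<D> S H))
        = card (integral_preimages (num_conj_classes G (S_family \<D> S H)) (table_of_marks G (reps H)))"
      if H: "H \<in> S - {carrier G}" for H
    proof -
      interpret conj_representatives G "S_family \<D> S H" "reps H"
        by unfold_locales (use H reps closed_fam in auto)
      show ?thesis unfolding card_bar by (rule card_integral_preimages[symmetric])
    qed
    thus ?thesis unfolding card by (intro arg_cong[where f = "\<lambda>n. 2 * n"] prod.cong refl)
  qed
  show ?thesis
    unfolding Let_def
    using fin card table bar_generators_subset generate_bar_generators
    unfolding bar_generators_def by blast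
qed

end
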